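(* Let $\vartheta_n=\theta_2-\theta_1$ and assume that, as $n\to\infty$, $\vartheta_n\to0$ and $\sqrt n\,\vartheta_n/\sqrt{\log n}\to\infty$; let $\theta_0$ be the limiting value of both $\theta_1$ and $\theta_2$. With $\hat k_0$ the least squares change point estimator defined in the context, let $$\hat\theta_1=\frac1{\hat k_0}\sum_{i=1}^{\hat k_0}Z_i^2,\qquad \hat\theta_2=\frac1{n-\hat k_0}\sum_{i=\hat k_0+1}^nZ_i^2 .$$ Then, as $n\to\infty$ with $n\Delta_n=T$, $$\sqrt n\begin{pmatrix}\hat\theta_1-\theta_1\\ \hat\theta_2-\theta_2\end{pmatrix}\ \stackrel{d}{\to}\ N(0,\Sigma),\qquad \Sigma=\begin{pmatrix}2\tau_0^{-1}\theta_0^2&0\\0&2(1-\tau_0)^{-1}\theta_0^2\end{pmatrix}.$$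
   Context: $[x]$ denotes the integer part of $x$. Model: $X=\{X_t,0\le t\le T\}$ is a one-dimensional diffusion with state space $I=(l,r)$, $-\infty\le l\le r\le+\infty$, solving $dX_t=b(X_t)\,dt+\sqrt{\theta}\,\sigma(X_t)\,dW_t$, $X_0=x_0$, with $W$ a standard Brownian motion and $\theta=\theta_1 1_{\{t\le t^*\}}+\theta_2 1_{\{t>t^*\}}$, $t^*\in(0,T)$ unknown, where $\theta_1,\theta_2$ (which here depend on $n$) lie in a compact set $\Theta\subset(0,\infty)$. Here $b:I\to\mathbb R$ and $\sigma:I\to(0,\infty)$ are known with continuous derivatives. With $s(x)=\exp\{-\int_{x_0}^x 2b(u)/\sigma^2(u)\,du\}$, it is assumed that $\lim_{x_1\to l}\int_{x_1}^x s(u)du=-\infty$ and $\lim_{x_2\to r}\int_x^{x_2}s(u)du=+\infty$ for $l<x_1<x<x_2<r$ (a condition imposed so that $X$ does not exit $I$). $X$ is observed at times $t_i=i\Delta_n$, $i=0,\dots,n$, with $T=n\Delta_n$ and $\Delta_n\to0$ as $n\to\infty$; write $X_i=X_{t_i}$, $W_i=W_{t_i}$. The change occurs at $t^*=k_0\Delta_n$, $k_0=[n\tau_0]$, with $\tau_0\in(0,1)$ fixed. One works under the Euler approximation $X_i=X_{i-1}+b(X_{i-1})\Delta_n+\sqrt{\theta}\,\sigma(X_{i-1})(W_i-W_{i-1})$ (with $\theta=\theta_1$ for $i\le k_0$ and $\theta=\theta_2$ for $i>k_0$), so that $$Z_i=\frac{X_i-X_{i-1}-b(X_{i-1})\Delta_n}{\sqrt{\Delta_n}\,\sigma(X_{i-1})}=\sqrt\theta\,\frac{W_i-W_{i-1}}{\sqrt{\Delta_n}},\qquad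 i=1,\dots,n,$$ are independent, $Z_i\sim N(0,\theta_1)$ for $i\le k_0$ and $Z_i\sim N(0,\theta_2)$ for $i>k_0$. The least squares estimator is $$\hat k_0=\arg\min_{1\le k\le n-1}\left\{\sum_{i=1}^k(Z_i^2-\bar\theta_1)^2+\sum_{i=k+1}^n(Z_i^2-\bar\theta_2)^2\right\},\quad \bar\theta_1=\frac1k\sum_{i=1}^kZ_i^2,\quad \bar\theta_2=\frac1{n-k}\sum_{i=k+1}^nZ_i^2;$$ equivalently $\hat k_0=\arg\max_k V_k^2$ with $V_k=\left(\frac{k(n-k)}{n^2}\right)^{1/2}(\bar\theta_2-\bar\theta_1)$.
   Formalization: The scale condition at l is read as lim ∫_x^{x_1} s(u)du = −∞ as x_1→l, since the printed ∫_{x_1}^x s is positive and cannot tend to −∞; b and σ are extended outside I with σ nonzero, because the Euler scheme may leave I, where they are undefined. *)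

theory Defs
  imports "HOL-Probability.Probability"
begin

definition standard_brownian_motion :: "'a measure \<Rightarrow> (real \<Rightarrow> 'a \<Rightarrow> real) \<Rightarrow> bool" where
  "standard_brownian_motion M W \<longleftrightarrow>
     prob_space M \<and>
     (\<forall>t\<ge>0. W t \<in> borel_measurable M) \<and>
     (AE \<omega> in M. W 0 \<omega> = 0) \<and>
     (\<forall>(m::nat) (t::nat \<Rightarrow> real). 0 \<le> t 0 \<longrightarrow> (\<forall>i<m. t i \<le> t (Suc i)) \<longrightarrow>
        prob_space.indep_vars M (\<lambda>_. borel) (\<lambda>i \<omega>. W (t (Suc i)) \<omega> - W (t i) \<omega>) {..<m}) \<and>
     (\<forall>s t. 0 \<le> s \<longrightarrow> s < t \<longrightarrow>
        distributed M lborel (\<lambda>\<omega>. W t \<omega> - W s \<omega>) (normal_density 0 (sqrt (t - s)))) \<and>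
     (AE \<omega> in M. continuous_on {0..} (\<lambda>t. W t \<omega>))"

definition scale_density :: "(real \<Rightarrow> real) \<Rightarrow> (real \<Rightarrow> real) \<Rightarrow> real \<Rightarrow> real \<Rightarrow> real" where
  "scale_density b \<sigma> x0 x = exp (- (LBINT u=ereal x0..ereal x. 2 * b u / (\<sigma> u)\<^sup>2))"

definition standardized_residual ::
    "(real \<Rightarrow> real) \<Rightarrow> (real \<Rightarrow> real) \<Rightarrow> real \<Rightarrow> (nat \<Rightarrow> real) \<Rightarrow> nat \<Rightarrow> real" where
  "standardized_residual b \<sigma> \<delta> x i =
     (x i - x (i - 1) - b (x (i - 1)) * \<delta>) / (sqrt \<delta> * \<sigma> (x (i - 1)))"

definition mean_sq_before :: "(nat \<Rightarrow> real) \<Rightarrow> nat \<Rightarrow> real" where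
  "mean_sq_before z k = (\<Sum>i=1..k. (z i)\<^sup>2) / real k"

definition mean_sq_after :: "nat \<Rightarrow> (nat \<Rightarrow> real) \<Rightarrow> nat \<Rightarrow> real" where
  "mean_sq_after n z k = (\<Sum>i=k+1..n. (z i)\<^sup>2) / (real n - real k)"

definition residual_sum_of_squares :: "nat \<Rightarrow> (nat \<Rightarrow> real) \<Rightarrow> nat \<Rightarrow> real" where
  "residual_sum_of_squares n z k =
     (\<Sum>i=1..k. ((z i)\<^sup>2 - mean_sq_before z k)\<^sup>2) +
     (\<Sum>i=k+1..n. ((z i)\<^sup>2 - mean_sq_after n z k)\<^sup>2)"

text \<open>The argmin need not be unique; a least squares change point estimator is any
  measurable selection of a minimizer.\<close>

definition least_squares_change_point ::
    "'a measure \<Rightarrow> nat \<Rightarrow> (nat \<Rightarrow> 'a \<Rightarrow> real) \<Rightarrow> ('a \<Rightarrow> nat) \<Rightarrow> bool" where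
  "least_squares_change_point M n Z kh \<longleftrightarrow>
     kh \<in> measurable M (count_space UNIV) \<and>
     (\<forall>\<omega>\<in>space M. is_arg_min (residual_sum_of_squares n (\<lambda>i. Z i \<omega>))
                             (\<lambda>k. 1 \<le> k \<and> k \<le> n - 1) (kh \<omega>))"

text \<open>The Lebesgue density describes the normal law only for positive definite \<open>\<Sigma>\<close>.\<close>

definition multivariate_normal_density :: "real^'n \<Rightarrow> real^'n^'n \<Rightarrow> real^'n \<Rightarrow> real" where
  "multivariate_normal_density \<mu> \<Sigma> x =
     exp (- ((x - \<mu>) \<bullet> (matrix_inv \<Sigma> *v (x - \<mu>))) / 2) /
     sqrt ((2 * pi) ^ CARD('n) * det \<Sigma>)"

definition multivariate_normal :: "real^'n \<Rightarrow> real^'n^'n \<Rightarrow> (real^'n) measure" where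
  "multivariate_normal \<mu> \<Sigma> =
     density lborel (\<lambda>x. ennreal (multivariate_normal_density \<mu> \<Sigma> x))"

text \<open>The library's weak convergence is restricted to laws on the real line.  Measurability is
  requested explicitly because the Bochner integral of a non-integrable function is \<open>0\<close>; it is
  needed only eventually, as finitely many members of a sequence are irrelevant.\<close>

definition converges_in_distribution ::
    "'a measure \<Rightarrow> (nat \<Rightarrow> 'a \<Rightarrow> 'b::euclidean_space) \<Rightarrow> 'b measure \<Rightarrow> bool" where
  "converges_in_distribution M Y L \<longleftrightarrow>
     (\<forall>\<^sub>F n in sequentially. Y n \<in> borel_measurable M) \<and>
     (\<forall>f :: 'b \<Rightarrow> real. continuous_on UNIV f \<longrightarrow> bounded (range f) \<longrightarrow>
        (\<lambda>n. integral\<^sup>L M (\<lambda>\<omega>. f (Y n \<omega>))) \<longlonglongrightarrow> integral\<^sup>L L f)"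

end

theory Submission
  imports Defs
begin

text \<open>
  Write \<open>Z\<^sub>i\<^sup>2 = \<theta> + e\<^sub>i\<close> with centred independent noise \<open>e\<^sub>i = \<theta> (\<xi>\<^sub>i\<^sup>2 - 1)\<close>. If the sample is cut into
  consecutive blocks \<open>A, B, C\<close> with the change between \<open>A\<close> and \<open>B\<close>, then preferring the cut between
  \<open>B\<close> and \<open>C\<close> means exactly \<open>|A|/(|A|+|B|) (m\<^sub>A - m\<^sub>B)\<^sup>2 \<le> |C|/(|B|+|C|) (m\<^sub>B - m\<^sub>C)\<^sup>2\<close> for the block means.
  The left side is of order \<open>(\<theta>\<^sub>2 - \<theta>\<^sub>1)\<^sup>2\<close>, and the Hajek-Renyi inequality makes the right side smaller
  uniformly in all blocks \<open>B\<close> of length at least \<open>d\<close>, as long as \<open>d (\<theta>\<^sub>2 - \<theta>\<^sub>1)\<^sup>2\<close> and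
  \<open>n (\<theta>\<^sub>2 - \<theta>\<^sub>1)\<^sup>2 / ln n\<close> tend to infinity. Hence the estimated change point is within \<open>d\<close> of the
  true one, where \<open>d\<close> can still be taken to be \<open>o(sqrt n / (\<theta>\<^sub>2 - \<theta>\<^sub>1))\<close>; then replacing the estimated by the
  true change point alters the two means by \<open>o(1 / sqrt n)\<close>. The means at the true change point are
  independent normalized chi-square sums, whose joint limit follows from the one-dimensional central
  limit theorem by Skorohod coupling, and Slutsky's theorem concludes.
\<close>

section \<open>The Hajek-Renyi inequality\<close>

text \<open>The block \<open>C\<close> at an end of the sample may consist of a single observation,
  so its mean is not uniformly small; only the factor \<open>|C|/(|B|+|C|)\<close> damps it. What is
  needed is a bound \<open>l * sqrt (|C| * (|B|+|C|))\<close> on its noise sum, and since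
  \<open>|B|+|C|\<close> is the fixed length of one true segment, this is a maximal inequality with
  weights \<open>1 / sqrt k\<close>. Their squares form a harmonic sum, and this is where the
  \<open>ln n\<close> of the rate assumption is spent. The least squares argument itself is
  deterministic, given bounds on the partial sums of the noise read outwards from the change point
  and inwards from both ends; probability enters only through the event that these bounds hold. The
  noise is a triangular array, since the grid changes with \<open>n\<close>, whereas the central
  limit theorem concerns one sequence. As the standardized noise is exactly Gaussian, the law of a
  normalized sum depends on its length alone, so a limit for these laws can be used along the two
  segment lengths.\<close>

lemma abs_mult_le_sum_squares: "\<bar>a\<bar> * \<bar>b\<bar> \<le> a\<^sup>2 + b\<^sup>2" for a b :: real
proof -
  have "2 * \<bar>a\<bar> * \<bar>b\<bar> \<le> a\<^sup>2 + b\<^sup>2"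
    using sum_squares_bound[of "\<bar>a\<bar>" "\<bar>b\<bar>"] by simp
  moreover have "0 \<le> \<bar>a\<bar> * \<bar>b\<bar>" by simp
  ultimately show ?thesis by linarith
qed

context prob_space
begin

text \<open>Injectivity of \<open>h\<close> makes the singletons \<open>{h j}\<close> disjoint, so
  independence of disjoint groups applies. This is what allows noise to be read backwards, or from
  the change point on.\<close>

lemma indep_vars_reindex:
  assumes ind: "indep_vars (\<lambda>_. N) X I" and h: "inj_on h J" "h ` J \<subseteq> I"
  shows "indep_vars (\<lambda>_. N) (\<lambda>j. X (h j)) J"
proof -
  have "indep_vars (\<lambda>j. PiM {h j} (\<lambda>_. N)) (\<lambda>j \<omega>. restrict (\<lambda>i. X i \<omega>) {h j}) J"
    using h by (intro indep_vars_restrict[OF ind]) (auto simp: disjoint_family_on_def inj_on_def)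
  from indep_vars_compose2[OF this, of "\<lambda>j f. f (h j)" "\<lambda>_. N"]
  show ?thesis by simp
qed

text \<open>Stands in for a filtration: the survival indicator and the stopped partial sum of the
  maximal inequality are functions \<open>g\<close> of the past.\<close>

lemma indep_var_past_next:
  assumes ind: "indep_vars (\<lambda>_. borel) (X :: nat \<Rightarrow> 'a \<Rightarrow> real) {..<m}" and k: "k < m"
    and g: "g \<in> borel_measurable (PiM {..<k} (\<lambda>_. borel))"
    and h: "h \<in> borel_measurable borel"
  shows "indep_var borel (\<lambda>\<omega>. g (restrict (\<lambda>i. X i \<omega>) {..<k})) borel (\<lambda>\<omega>. h (X k \<omega>) :: real)"
proof -
  have "indep_var (PiM {..<k} (\<lambda>_. borel)) (\<lambda>\<omega>. restrict (\<lambda>i. X i \<omega>) {..<k})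
          (PiM {k} (\<lambda>_. borel)) (\<lambda>\<omega>. restrict (\<lambda>i. X i \<omega>) {k})"
    using k by (intro indep_var_restrict[OF ind]) auto
  from indep_var_compose[OF this g, of "\<lambda>f. h (f k)" borel] h
  show ?thesis by (simp add: o_def)
qed

text \<open>By induction on \<open>k\<close>: on the event that the weighted partial sums have stayed below \<open>\<lambda>\<close>
  up to time \<open>k\<close>, the next increment is orthogonal to the partial sum, and the weights decrease.\<close>

theorem hajek_renyi:
  fixes X :: "nat \<Rightarrow> 'a \<Rightarrow> real" and c :: "nat \<Rightarrow> real"
  assumes ind: "indep_vars (\<lambda>_. borel) X {..<m}"
    and int2: "\<And>i. i < m \<Longrightarrow> integrable M (\<lambda>\<omega>. (X i \<omega>)\<^sup>2)"
    and mean: "\<And>i. i < m \<Longrightarrow> expectation (X i) = 0"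
    and var: "\<And>i. i < m \<Longrightarrow> expectation (\<lambda>\<omega>. (X i \<omega>)\<^sup>2) \<le> v"
    and c: "\<And>k. 0 \<le> c k" "\<And>k. 1 \<le> k \<Longrightarrow> c (Suc k) \<le> c k"
    and "0 < t"
  shows "prob {\<omega>\<in>space M. \<exists>k\<in>{1..m}. t \<le> c k * \<bar>\<Sum>i<k. X i \<omega>\<bar>} \<le> v * (\<Sum>k=1..m. (c k)\<^sup>2) / t\<^sup>2"
proof -
  have meas [measurable]: "random_variable borel (X i)" if "i < m" for i
    using ind that by (auto simp: indep_vars_def)
  have int1: "integrable M (X i)" if "i < m" for i
    using square_integrable_imp_integrable[OF meas int2] that by auto
  define S where "S k \<omega> = (\<Sum>i<k. X i \<omega>)" for k \<omega>
  \<comment> \<open>The indicator of survival up to time \<open>k\<close>, as a real function so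
    that it can be multiplied into expectations; it equals its own square.\<close>
  define J :: "nat \<Rightarrow> 'a \<Rightarrow> real"
    where "J k \<omega> = of_bool (\<forall>j\<in>{1..k}. c j * \<bar>S j \<omega>\<bar> < t)" for k \<omega>
  have mS [measurable]: "random_variable borel (S k)" if "k \<le> m" for k
    using that unfolding S_def by (intro borel_measurable_sum) auto
  have mJ [measurable]: "random_variable borel (J k)" if "k \<le> m" for k
  proof -
    have "Measurable.pred M (\<lambda>\<omega>. c j * \<bar>S j \<omega>\<bar> < t)" if "j \<in> {1..k}" for j
    proof -
      have [measurable]: "random_variable borel (S j)" using mS \<open>k \<le> m\<close> that by simp
      show ?thesis by measurable
    qed
    then have "Measurable.pred M (\<lambda>\<omega>. \<forall>j\<in>{1..k}. c j * \<bar>S j \<omega>\<bar> < t)"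
      by measurable
    then show ?thesis unfolding J_def of_bool_def by measurable
  qed
  have J01: "0 \<le> J k \<omega>" "J k \<omega> \<le> 1" for k \<omega>
    by (simp_all add: J_def)
  have intS: "integrable M (\<lambda>\<omega>. (S k \<omega>)\<^sup>2)" if "k \<le> m" for k
    using that
  proof (induction k)
    case (Suc k)
    then have [measurable]: "random_variable borel (S k)" "random_variable borel (X k)"
      using mS meas by auto
    have "integrable M (\<lambda>\<omega>. S k \<omega> * X k \<omega>)"
    proof (rule Bochner_Integration.integrable_bound[of _ "\<lambda>\<omega>. (S k \<omega>)\<^sup>2 + (X k \<omega>)\<^sup>2"])
      show "AE \<omega> in M. norm (S k \<omega> * X k \<omega>) \<le> norm ((S k \<omega>)\<^sup>2 + (X k \<omega>)\<^sup>2)"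
        using abs_mult_le_sum_squares by (intro AE_I2) (simp add: abs_mult)
      show "integrable M (\<lambda>\<omega>. (S k \<omega>)\<^sup>2 + (X k \<omega>)\<^sup>2)"
        using Suc int2 by simp
    qed measurable
    then have "integrable M (\<lambda>\<omega>. (S k \<omega>)\<^sup>2 + 2 * (S k \<omega> * X k \<omega>) + (X k \<omega>)\<^sup>2)"
      using Suc int2 by auto
    then show ?case by (simp add: S_def power2_sum algebra_simps)
  qed (simp add: S_def)
  have intJS: "integrable M (\<lambda>\<omega>. J k \<omega> * (S l \<omega>)\<^sup>2)" if "k \<le> m" "l \<le> m" for k l
  proof (rule Bochner_Integration.integrable_bound[OF intS[OF that(2)]])
    show "(\<lambda>\<omega>. J k \<omega> * (S l \<omega>)\<^sup>2) \<in> borel_measurable M"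
      using mJ[OF that(1)] mS[OF that(2)] by measurable
  qed (auto simp: J_def)
  have intJ: "integrable M (J k)" if "k \<le> m" for k
    using mJ[OF that] by (intro integrable_const_bound[of _ 1]) (auto simp: J_def)
  \<comment> \<open>The first summand is \<open>t\<^sup>2\<close> times the probability of having
    crossed. The second keeps the weighted energy of the surviving paths, which pays for later
    crossings.\<close>
  have main: "t\<^sup>2 * (1 - expectation (J k)) + (c k)\<^sup>2 * expectation (\<lambda>\<omega>. J k \<omega> * (S k \<omega>)\<^sup>2)
      \<le> v * (\<Sum>j=1..k. (c j)\<^sup>2)" if "k \<le> m" for k
    using that
  proof (induction k)
    case 0
    then show ?case by (simp add: S_def J_def prob_space)
  next
    case (Suc k)
    have km: "k < m" "k \<le> m" using Suc.prems by simp_all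
    note intJS' = intJS[OF km(2) km(2)]
    have v: "0 \<le> v"
      using var[OF km(1)] by (rule order_trans[rotated]) simp
    let ?P = "PiM {..<k} (\<lambda>_. borel :: real measure)"
    let ?g = "\<lambda>f::nat\<Rightarrow>real. of_bool (\<forall>j\<in>{1..k}. c j * \<bar>\<Sum>i<j. f i\<bar> < t) :: real"
    have mgJ [measurable]: "?g \<in> borel_measurable ?P"
    proof -
      have "(\<lambda>f. \<Sum>i<j. f i) \<in> borel_measurable ?P" if "j \<in> {1..k}" for j
        using that by (intro borel_measurable_sum measurable_component_singleton) auto
      then have "Measurable.pred ?P (\<lambda>f. \<forall>j\<in>{1..k}. c j * \<bar>\<Sum>i<j. f i\<bar> < t)"
        by measurable
      then show ?thesis unfolding of_bool_def by measurable
    qed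
    have mgS [measurable]: "(\<lambda>f. \<Sum>i<k. f i) \<in> borel_measurable ?P"
      by (intro borel_measurable_sum measurable_component_singleton) auto
    have Jeq: "J k = (\<lambda>\<omega>. ?g (restrict (\<lambda>i. X i \<omega>) {..<k}))"
      by (auto simp: J_def S_def fun_eq_iff intro!: arg_cong[where f=of_bool] ball_cong)
    have Seq: "S k = (\<lambda>\<omega>. \<Sum>i<k. restrict (\<lambda>i. X i \<omega>) {..<k} i)"
      by (simp add: S_def fun_eq_iff)
    have ind1: "indep_var borel (\<lambda>\<omega>. J k \<omega> * S k \<omega>) borel (X k)"
      unfolding Jeq Seq
      by (rule indep_var_past_next[OF ind km(1), of "\<lambda>f. ?g f * (\<Sum>i<k. f i)" "\<lambda>x. x"]) measurable
    have ind2: "indep_var borel (J k) borel (\<lambda>\<omega>. (X k \<omega>)\<^sup>2)"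
      unfolding Jeq by (rule indep_var_past_next[OF ind km(1), of ?g "\<lambda>x. x\<^sup>2"]) measurable
    have intJS1: "integrable M (\<lambda>\<omega>. J k \<omega> * S k \<omega>)"
    proof (rule square_integrable_imp_integrable)
      have "(J k \<omega> * S k \<omega>)\<^sup>2 = J k \<omega> * (S k \<omega>)\<^sup>2" for \<omega>
        by (simp add: J_def)
      then show "integrable M (\<lambda>\<omega>. (J k \<omega> * S k \<omega>)\<^sup>2)" using intJS' by simp
    qed (use mJ[OF km(2)] mS[OF km(2)] in measurable)
    have cross: "expectation (\<lambda>\<omega>. J k \<omega> * S k \<omega> * X k \<omega>) = 0"
                "integrable M (\<lambda>\<omega>. J k \<omega> * S k \<omega> * X k \<omega>)"
      using indep_var_lebesgue_integral[OF ind1 intJS1 int1[OF km(1)]]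
        indep_var_integrable[OF ind1 intJS1 int1[OF km(1)]] mean[OF km(1)] by simp_all
    have sq: "expectation (\<lambda>\<omega>. J k \<omega> * (X k \<omega>)\<^sup>2) \<le> v"
             "integrable M (\<lambda>\<omega>. J k \<omega> * (X k \<omega>)\<^sup>2)"
    proof -
      have "expectation (\<lambda>\<omega>. J k \<omega> * (X k \<omega>)\<^sup>2) = expectation (J k) * expectation (\<lambda>\<omega>. (X k \<omega>)\<^sup>2)"
        using indep_var_lebesgue_integral[OF ind2 intJ[OF km(2)] int2[OF km(1)]] by simp
      also have "\<dots> \<le> 1 * v"
        using intJ[OF km(2)] J01 var[OF km(1)]
        by (intro mult_mono) (auto intro!: integral_le_const AE_I2)
      finally show "expectation (\<lambda>\<omega>. J k \<omega> * (X k \<omega>)\<^sup>2) \<le> v" by simp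
      show "integrable M (\<lambda>\<omega>. J k \<omega> * (X k \<omega>)\<^sup>2)"
        using indep_var_integrable[OF ind2 intJ[OF km(2)] int2[OF km(1)]] by simp
    qed
    let ?c = "(c (Suc k))\<^sup>2"
    have "t\<^sup>2 * (expectation (J k) - expectation (J (Suc k)))
          + ?c * expectation (\<lambda>\<omega>. J (Suc k) \<omega> * (S (Suc k) \<omega>)\<^sup>2)
        = expectation (\<lambda>\<omega>. t\<^sup>2 * (J k \<omega> - J (Suc k) \<omega>) + ?c * (J (Suc k) \<omega> * (S (Suc k) \<omega>)\<^sup>2))"
      using intJ intJS Suc.prems by simp
    \<comment> \<open>Pointwise: a path that survives step \<open>k\<close> and crosses at
      \<open>Suc k\<close> gives up its energy, which is at least \<open>t\<^sup>2\<close> at that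
      moment.\<close>
    also have "\<dots> \<le> expectation (\<lambda>\<omega>. ?c * (J k \<omega> * (S (Suc k) \<omega>)\<^sup>2))"
    proof (rule integral_mono)
      fix \<omega>
      have "t\<^sup>2 \<le> ?c * (S (Suc k) \<omega>)\<^sup>2" if "\<not> c (Suc k) * \<bar>S (Suc k) \<omega>\<bar> < t"
        using power_mono[of t "c (Suc k) * \<bar>S (Suc k) \<omega>\<bar>" 2] that \<open>0 < t\<close>
        by (simp add: power_mult_distrib)
      moreover have "{1..Suc k} = insert (Suc k) {1..k}" by auto
      ultimately show "t\<^sup>2 * (J k \<omega> - J (Suc k) \<omega>) + ?c * (J (Suc k) \<omega> * (S (Suc k) \<omega>)\<^sup>2)
          \<le> ?c * (J k \<omega> * (S (Suc k) \<omega>)\<^sup>2)"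
        unfolding J_def by auto
    qed (use intJ intJS Suc.prems in auto)
    also have "\<dots> = ?c * expectation (\<lambda>\<omega>. J k \<omega> * (S k \<omega>)\<^sup>2 + 2 * (J k \<omega> * S k \<omega> * X k \<omega>) + J k \<omega> * (X k \<omega>)\<^sup>2)"
    proof -
      have "J k \<omega> * (S (Suc k) \<omega>)\<^sup>2
          = J k \<omega> * (S k \<omega>)\<^sup>2 + 2 * (J k \<omega> * S k \<omega> * X k \<omega>) + J k \<omega> * (X k \<omega>)\<^sup>2" for \<omega>
        by (simp add: S_def power2_sum algebra_simps)
      then show ?thesis by simp
    qed
    also have "\<dots> \<le> ?c * (expectation (\<lambda>\<omega>. J k \<omega> * (S k \<omega>)\<^sup>2) + v)"
      using cross sq intJS' by (intro mult_left_mono) auto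
    also have "\<dots> \<le> (c k)\<^sup>2 * expectation (\<lambda>\<omega>. J k \<omega> * (S k \<omega>)\<^sup>2) + v * ?c"
    proof (cases "k = 0")
      case False
      then have "?c \<le> (c k)\<^sup>2" using c by (intro power_mono) auto
      moreover have "0 \<le> expectation (\<lambda>\<omega>. J k \<omega> * (S k \<omega>)\<^sup>2)"
        by (simp add: J_def)
      ultimately show ?thesis by (simp add: algebra_simps mult_right_mono)
    qed (simp add: S_def)
    finally show ?case using Suc.IH[OF km(2)] by (simp add: algebra_simps)
  qed
  have "{\<omega>\<in>space M. \<exists>k\<in>{1..m}. t \<le> c k * \<bar>\<Sum>i<k. X i \<omega>\<bar>} = {\<omega>\<in>space M. J m \<omega> < 1/2}" (is "?B = _")
    by (auto simp: J_def S_def not_less)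
  then have "?B \<in> events" using mJ[of m] by measurable
  have "expectation (\<lambda>\<omega>. 1 - J m \<omega>) = expectation (indicator ?B)"
    by (intro Bochner_Integration.integral_cong) (auto simp: J_def S_def indicator_def not_less)
  then have "prob ?B = 1 - expectation (J m)"
    using intJ[of m] \<open>?B \<in> events\<close> by (simp add: prob_space)
  moreover have "0 \<le> (c m)\<^sup>2 * expectation (\<lambda>\<omega>. J m \<omega> * (S m \<omega>)\<^sup>2)"
    by (simp add: J_def)
  ultimately have "t\<^sup>2 * prob ?B \<le> v * (\<Sum>j=1..m. (c j)\<^sup>2)"
    using main[of m] by simp
  then show ?thesis using \<open>0 < t\<close> by (simp add: field_simps)
qed

end

section \<open>Least squares on blocks\<close>

text \<open>Blocks are arbitrary index sets rather than intervals, so that one set of lemmas serves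
  estimates on either side of the change point.\<close>

definition block_mean :: "('i \<Rightarrow> real) \<Rightarrow> 'i set \<Rightarrow> real" where
  "block_mean y A = sum y A / real (card A)"

definition block_rss :: "('i \<Rightarrow> real) \<Rightarrow> 'i set \<Rightarrow> real" where
  "block_rss y A = (\<Sum>i\<in>A. (y i - block_mean y A)\<^sup>2)"

lemma block_rss_eq:
  assumes "finite A" "A \<noteq> {}"
  shows "block_rss y A = (\<Sum>i\<in>A. (y i)\<^sup>2) - real (card A) * (block_mean y A)\<^sup>2"
proof -
  have "sum y A = real (card A) * block_mean y A"
    using assms by (simp add: block_mean_def)
  then show ?thesis
    unfolding block_rss_def
    by (simp add: power2_diff sum.distrib sum_subtractf algebra_simps power2_eq_square
        flip: sum_distrib_left sum_distrib_right)
qed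

text \<open>The decomposition of variance into the parts within and between two groups: the last
  term is the price of fitting one common mean.\<close>

lemma block_rss_Un:
  assumes "finite A" "A \<noteq> {}" "finite B" "B \<noteq> {}" "A \<inter> B = {}"
  shows "block_rss y (A \<union> B) = block_rss y A + block_rss y B
    + real (card A) * real (card B) / real (card A + card B) * (block_mean y A - block_mean y B)\<^sup>2"
proof -
  let ?a = "real (card A)" and ?b = "real (card B)"
  let ?p = "block_mean y A" and ?q = "block_mean y B"
  have ab: "?a > 0" "?b > 0" using assms by (simp_all add: card_gt_0_iff)
  have "sum y A = ?a * ?p" "sum y B = ?b * ?q"
    using ab by (simp_all add: block_mean_def)
  then have m: "block_mean y (A \<union> B) = (?a * ?p + ?b * ?q) / (?a + ?b)"
    using assms by (simp add: block_mean_def sum.union_disjoint card_Un_disjoint)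
  have "?a * ?p\<^sup>2 + ?b * ?q\<^sup>2 - (?a + ?b) * ((?a * ?p + ?b * ?q) / (?a + ?b))\<^sup>2
      = ?a * ?b / (?a + ?b) * (?p - ?q)\<^sup>2"
    using ab by (simp add: divide_simps power2_eq_square add_pos_pos) (simp add: algebra_simps)
  then show ?thesis
    using assms by (simp add: block_rss_eq m card_Un_disjoint sum.union_disjoint)
qed

text \<open>Expanding both unions by \<open>block_rss_Un\<close> cancels the three separate residual
  sums; what remains has the common factor \<open>card B\<close>.\<close>

lemma block_rss_transfer:
  assumes "finite A" "A \<noteq> {}" "finite B" "B \<noteq> {}" "finite C" "C \<noteq> {}"
    and "A \<inter> B = {}" "B \<inter> C = {}"
    and le: "block_rss y (A \<union> B) + block_rss y C \<le> block_rss y A + block_rss y (B \<union> C)"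
  shows "real (card A) / real (card A + card B) * (block_mean y A - block_mean y B)\<^sup>2
    \<le> real (card C) / real (card B + card C) * (block_mean y B - block_mean y C)\<^sup>2"
proof -
  have b: "real (card B) > 0" using assms by (simp add: card_gt_0_iff)
  have "real (card B) * (real (card A) / real (card A + card B) * (block_mean y A - block_mean y B)\<^sup>2)
      \<le> real (card B) * (real (card C) / real (card B + card C) * (block_mean y B - block_mean y C)\<^sup>2)"
    using le assms by (simp add: block_rss_Un ac_simps)
  then show ?thesis using b by (simp only: mult_le_cancel_left_pos)
qed

text \<open>If the wrong cut were not worse, \<open>block_rss_transfer\<close> would give
  \<open>\<kappa> * |m_A - m_B| \<le> q * |m_B - m_C|\<close> for the block means. The left side is
  at least \<open>\<kappa> * (|a - b| - 2 * l)\<close>; on the right the level \<open>b\<close>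
  cancels and noise of size at most \<open>2 * l\<close> remains. Hence
  \<open>\<kappa> * |a - b| \<le> 4 * l\<close>, and the 5 in the choice of \<open>l\<close> only
  has to exceed this 4.\<close>

lemma block_shift_rejected:
  fixes e y :: "'i \<Rightarrow> real"
  assumes fin: "finite A" "A \<noteq> {}" "finite B" "B \<noteq> {}" "finite C" "C \<noteq> {}"
    and disj: "A \<inter> B = {}" "B \<inter> C = {}"
    and yA: "\<And>i. i \<in> A \<Longrightarrow> y i = a + e i" and yBC: "\<And>i. i \<in> B \<union> C \<Longrightarrow> y i = b + e i"
    and \<kappa>: "0 < \<kappa>" "\<kappa> \<le> 1" "\<kappa>\<^sup>2 * real (card A + card B) \<le> real (card A)"
    and l: "l = \<kappa> / 5 * \<bar>a - b\<bar>" "a \<noteq> b"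
    and eA: "\<bar>sum e A\<bar> < l * real (card A)" and eB: "\<bar>sum e B\<bar> < l * real (card B)"
    and eC: "\<bar>sum e C\<bar> < l * sqrt (real (card C) * real (card B + card C))"
  shows "block_rss y A + block_rss y (B \<union> C) < block_rss y (A \<union> B) + block_rss y C"
proof (rule ccontr)
  assume "\<not> ?thesis"
  then have "block_rss y (A \<union> B) + block_rss y C \<le> block_rss y A + block_rss y (B \<union> C)"
    by simp
  note tr = block_rss_transfer[OF fin disj this]
  have pos: "real (card A) > 0" "real (card B) > 0" "real (card C) > 0"
    using fin by (simp_all add: card_gt_0_iff)
  \<comment> \<open>The square root of the damping factor of \<open>C\<close>, which turns the right
    side of \<open>tr\<close> into a square.\<close>
  define q where "q = sqrt (real (card C) / real (card B + card C))"
  have q: "0 < q" "q \<le> 1" "q\<^sup>2 = real (card C) / real (card B + card C)"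
    using pos by (simp_all add: q_def)
  have mA: "block_mean y A = a + sum e A / real (card A)"
    using pos yA by (simp add: block_mean_def sum.distrib add_divide_distrib cong: sum.cong)
  have mB: "block_mean y B = b + sum e B / real (card B)"
    using pos yBC by (simp add: block_mean_def sum.distrib add_divide_distrib cong: sum.cong)
  have mC: "block_mean y C = b + sum e C / real (card C)"
    using pos yBC by (simp add: block_mean_def sum.distrib add_divide_distrib cong: sum.cong)
  have l0: "0 < l" using l(2) \<kappa> unfolding l(1) by simp
  have dA: "\<bar>sum e A / real (card A)\<bar> < l" and dB: "\<bar>sum e B / real (card B)\<bar> < l"
    using eA eB pos by (simp_all add: divide_simps)
  \<comment> \<open>The geometric mean in \<open>eC\<close> is made for this: multiplied by
    \<open>q\<close> it becomes \<open>l * real (card C)\<close>.\<close>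
  have "q * \<bar>sum e C\<bar> < q * (l * sqrt (real (card C) * real (card B + card C)))"
    using eC q by simp
  also have "\<dots> = l * real (card C)"
    using pos by (simp add: q_def real_sqrt_divide real_sqrt_mult)
  finally have dC: "q * \<bar>sum e C / real (card C)\<bar> < l"
    using pos by (simp add: divide_simps)
  have "\<kappa>\<^sup>2 \<le> real (card A) / real (card A + card B)"
    using \<kappa> pos by (simp add: divide_simps)
  then have "(\<kappa> * (block_mean y A - block_mean y B))\<^sup>2
      \<le> real (card A) / real (card A + card B) * (block_mean y A - block_mean y B)\<^sup>2"
    unfolding power_mult_distrib by (rule mult_right_mono) simp
  also have "\<dots> \<le> (q * (block_mean y B - block_mean y C))\<^sup>2"
    using tr by (simp add: q power_mult_distrib)
  finally have "\<kappa> * \<bar>block_mean y A - block_mean y B\<bar> \<le> q * \<bar>block_mean y B - block_mean y C\<bar>"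
    using \<kappa> q by (simp add: abs_mult flip: abs_le_square_iff)
  moreover have "\<kappa> * (\<bar>a - b\<bar> - 2 * l) \<le> \<kappa> * \<bar>block_mean y A - block_mean y B\<bar>"
  proof (rule mult_left_mono)
    show "\<bar>a - b\<bar> - 2 * l \<le> \<bar>block_mean y A - block_mean y B\<bar>"
      unfolding mA mB using dA dB by linarith
  qed (use \<kappa> in simp)
  moreover have "q * \<bar>block_mean y B - block_mean y C\<bar> \<le> l + l"
  proof -
    have "q * \<bar>block_mean y B - block_mean y C\<bar>
        \<le> q * (\<bar>sum e B / real (card B)\<bar> + \<bar>sum e C / real (card C)\<bar>)"
      using q unfolding mB mC by (intro mult_left_mono) linarith+
    also have "\<dots> \<le> 1 * \<bar>sum e B / real (card B)\<bar> + q * \<bar>sum e C / real (card C)\<bar>"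
      using q by (simp only: distrib_left, intro add_right_mono mult_right_mono) auto
    finally show ?thesis using dB dC by simp
  qed
  moreover have "\<kappa> * l \<le> l" using \<kappa> l0 by simp
  ultimately have "\<kappa> * \<bar>a - b\<bar> \<le> 4 * l"
    by (simp add: right_diff_distrib)
  then show False using l \<kappa> by simp
qed

text \<open>Three errors arise when a block \<open>B\<close> from the other regime is added: its
  noise, its bias \<open>b - a\<close>, and the dilution of the mean noise of
  \<open>A\<close>.\<close>

lemma block_mean_extend:
  fixes e y :: "'i \<Rightarrow> real"
  assumes fin: "finite A" "A \<noteq> {}" "finite B" and disj: "A \<inter> B = {}"
    and yA: "\<And>i. i \<in> A \<Longrightarrow> y i = a + e i" and yB: "\<And>i. i \<in> B \<Longrightarrow> y i = b + e i"
    and eA: "\<bar>sum e A\<bar> \<le> l * real (card A)" and eB: "\<bar>sum e B\<bar> \<le> m"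
  shows "\<bar>block_mean y (A \<union> B) - a - sum e A / real (card A)\<bar>
    \<le> (m + (l + \<bar>b - a\<bar>) * real (card B)) / real (card (A \<union> B))"
proof -
  let ?a = "real (card A)" and ?b = "real (card B)"
  have pos: "?a > 0" using fin by (simp add: card_gt_0_iff)
  have c: "real (card (A \<union> B)) = ?a + ?b" using fin disj by (simp add: card_Un_disjoint)
  have s: "sum y (A \<union> B) = ?a * a + sum e A + (?b * b + sum e B)"
    using fin disj yA yB by (simp add: sum.union_disjoint sum.distrib cong: sum.cong)
  have "block_mean y (A \<union> B) - a - sum e A / ?a
      = (sum e B + (b - a) * ?b - sum e A / ?a * ?b) / (?a + ?b)"
    using pos unfolding block_mean_def c s by (simp add: divide_simps) (simp add: algebra_simps)
  moreover have "\<bar>sum e B + (b - a) * ?b - sum e A / ?a * ?b\<bar> \<le> m + (l + \<bar>b - a\<bar>) * ?b"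
  proof -
    have "\<bar>sum e A / ?a\<bar> \<le> l" using eA pos by (simp add: divide_simps)
    then have "\<bar>sum e A / ?a * ?b\<bar> \<le> l * ?b" using mult_right_mono[of _ l ?b] by (simp only: abs_mult abs_of_nat of_nat_0_le_iff)
    moreover have "\<bar>(b - a) * ?b\<bar> = \<bar>b - a\<bar> * ?b" by (simp add: abs_mult)
    ultimately show ?thesis using eB unfolding distrib_right by linarith
  qed
  ultimately show ?thesis using pos c by (simp add: divide_right_mono)
qed

text \<open>The removed observations have the right level, so there is no bias term. The inclusion
  is strict in order that a nonempty block remains.\<close>

lemma block_mean_shrink:
  fixes e y :: "'i \<Rightarrow> real"
  assumes fin: "finite A" "B \<subset> A"
    and yA: "\<And>i. i \<in> A \<Longrightarrow> y i = a + e i"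
    and eA: "\<bar>sum e A\<bar> \<le> l * real (card A)" and eB: "\<bar>sum e B\<bar> \<le> m"
  shows "\<bar>block_mean y (A - B) - a - sum e A / real (card A)\<bar>
    \<le> (m + l * real (card B)) / real (card (A - B))"
proof -
  let ?a = "real (card A)" and ?b = "real (card B)"
  have finB: "finite B" using fin by (meson finite_subset psubset_imp_subset)
  have pos: "?a > ?b" using psubset_card_mono[OF fin] by simp
  have c: "real (card (A - B)) = ?a - ?b"
    using fin finB by (simp add: card_Diff_subset psubset_imp_subset of_nat_diff card_mono)
  have s: "sum y (A - B) = (?a - ?b) * a + (sum e A - sum e B)"
  proof -
    have "sum y (A - B) = real (card (A - B)) * a + sum e (A - B)"
      using yA by (subst sum.cong[of _ "A - B" y "\<lambda>i. a + e i"]) (auto simp: sum.distrib)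
    then show ?thesis using fin finB c by (simp add: sum_diff psubset_imp_subset)
  qed
  have "block_mean y (A - B) - a - sum e A / ?a
      = (sum e A / ?a * ?b - sum e B) / (?a - ?b)"
    using pos unfolding block_mean_def c s by (simp add: divide_simps) (simp add: algebra_simps)
  moreover have "\<bar>sum e A / ?a * ?b - sum e B\<bar> \<le> m + l * ?b"
  proof -
    have "\<bar>sum e A / ?a\<bar> \<le> l" using eA pos by (simp add: divide_simps)
    then have "\<bar>sum e A / ?a * ?b\<bar> \<le> l * ?b" using mult_right_mono[of _ l ?b] by (simp only: abs_mult abs_of_nat of_nat_0_le_iff)
    then show ?thesis using eB by linarith
  qed
  ultimately show ?thesis using pos c by (simp add: divide_right_mono)
qed

section \<open>Localization of the least squares split\<close>

text \<open>In the application \<open>x\<close> is the noise read from the change point or from an end of the sample.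
  The square root bound keeps every block mean reaching that end small at the price of a factor
  \<open>ln n\<close>, the linear bound excludes estimates further than \<open>d\<close> from the change point, and the last
  one controls the noise picked up by the estimates within distance \<open>d\<close>.\<close>

definition tame :: "nat \<Rightarrow> nat \<Rightarrow> real \<Rightarrow> real \<Rightarrow> (nat \<Rightarrow> real) \<Rightarrow> bool" where
  "tame m d l \<mu> x \<longleftrightarrow> (\<forall>k\<in>{1..m}.
     \<bar>\<Sum>i<k. x i\<bar> < l * sqrt (real k * real m) \<and>
     \<bar>\<Sum>i<k. x i\<bar> < l * real (max d k) \<and>
     (k < d \<longrightarrow> \<bar>\<Sum>i<k. x i\<bar> < \<mu>))"

lemma tame_total:
  assumes "tame m d l \<mu> x" "1 \<le> m"
  shows "\<bar>\<Sum>i<m. x i\<bar> < l * real m"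
  using bspec[OF assms(1)[unfolded tame_def], of m] assms(2) by simp

lemma tame_sqrt:
  assumes "tame m d l \<mu> x" "1 \<le> k" "k \<le> m"
  shows "\<bar>\<Sum>i<k. x i\<bar> < l * sqrt (real k * real m)"
  using assms by (auto simp: tame_def)

lemma tame_linear:
  assumes "tame m d l \<mu> x" "1 \<le> k" "k \<le> m" "d \<le> k"
  shows "\<bar>\<Sum>i<k. x i\<bar> < l * real k"
  using bspec[OF assms(1)[unfolded tame_def], of k] assms(2-) by (simp add: max_absorb2)

lemma tame_near:
  assumes "tame m d l \<mu> x" "k < d" "k \<le> m" "0 < \<mu>"
  shows "\<bar>\<Sum>i<k. x i\<bar> \<le> \<mu>"
  using assms by (cases "k = 0") (force simp: tame_def)+

lemma sum_forward: "sum e {k+1..k+j} = (\<Sum>i<j. e (k + 1 + i))" for e :: "nat \<Rightarrow> real"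
  by (rule sum.reindex_bij_witness[of _ "\<lambda>i. k + 1 + i" "\<lambda>i. i - (k + 1)"]) auto

lemma sum_backward: "j \<le> k \<Longrightarrow> sum e {k-j+1..k} = (\<Sum>i<j. e (k - i))" for e :: "nat \<Rightarrow> real"
  by (rule sum.reindex_bij_witness[of _ "\<lambda>i. k - i" "\<lambda>i. k - i"]) auto

text \<open>For an estimate to the right of \<open>k0\<close>, the block between is controlled by
  the noise read forwards from \<open>k0\<close>, and the block after the estimate by the noise read
  backwards from \<open>n\<close>. The latter two blocks together have length \<open>n - k0\<close>,
  which makes the square root bound of \<open>tame\<close> the geometric mean asked for by
  \<open>block_shift_rejected\<close>. An estimate to the left is the mirror image.\<close>

lemma change_point_tame:
  fixes e y :: "nat \<Rightarrow> real"
  assumes k0: "1 \<le> k0" "k0 < n"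
    and y: "\<forall>i\<in>{1..n}. y i = (if i \<le> k0 then a else b) + e i"
    and \<kappa>: "0 < \<kappa>" "\<kappa> \<le> 1" "\<kappa>\<^sup>2 * real n \<le> real k0" "\<kappa>\<^sup>2 * real n \<le> real n - real k0"
    and l: "l = \<kappa> / 5 * \<bar>a - b\<bar>" "a \<noteq> b" and "0 < \<mu>" and "1 \<le> d"
    and right: "tame (n - k0) d l \<mu> (\<lambda>j. e (k0 + 1 + j))" "tame (n - k0) d l \<mu> (\<lambda>j. e (n - j))"
    and left: "tame k0 d l \<mu> (\<lambda>j. e (k0 - j))" "tame k0 d l \<mu> (\<lambda>j. e (1 + j))"
    and k: "is_arg_min (\<lambda>k. block_rss y {1..k} + block_rss y {k+1..n}) (\<lambda>k. 1 \<le> k \<and> k \<le> n - 1) k"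
  shows "k0 < k + d" "k < k0 + d"
    and "\<bar>block_mean y {1..k} - a - sum e {1..k0} / real k0\<bar> \<le> (\<mu> + 2 * \<bar>b - a\<bar> * real d) / real k"
    and "\<bar>block_mean y {k+1..n} - b - sum e {k0+1..n} / (real n - real k0)\<bar>
           \<le> (\<mu> + 2 * \<bar>b - a\<bar> * real d) / (real n - real k)"
proof -
  have k1: "1 \<le> k" "k < n" using k k0 by (auto simp: is_arg_min_def)
  have min: "block_rss y {1..k} + block_rss y {k+1..n} \<le> block_rss y {1..k0} + block_rss y {k0+1..n}"
    using k k0 by (force simp: is_arg_min_def not_less)
  have y1: "y i = a + e i" if "i \<in> {1..k0}" for i
    using that k0 by (simp add: y)
  have y2: "y i = b + e i" if "i \<in> {k0+1..n}" for i
    using that k0 by (simp add: y)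
  have ll: "l \<le> \<bar>b - a\<bar>" "0 \<le> l"
    using \<kappa> mult_right_mono[of "\<kappa> / 5" 1 "\<bar>a - b\<bar>"] by (auto simp: l(1) abs_minus_commute)
  have e1: "\<bar>sum e {1..k0}\<bar> < l * real (card {1..k0})"
    using tame_total[OF left(2)] k0 sum_forward[of e 0 k0] by simp
  have e2: "\<bar>sum e {k0+1..n}\<bar> < l * real (card {k0+1..n})"
    using tame_total[OF right(2)] k0 sum_backward[of "n - k0" n e] by simp
  note e12 = less_imp_le[OF e1] less_imp_le[OF e2]
  \<comment> \<open>One bound for all four cases: \<open>l \<le> |b - a|\<close> makes the
    coefficient at most \<open>2 * |b - a|\<close>, and the displacement \<open>j\<close> is below
    \<open>d\<close>.\<close>
  have upper: "(\<mu> + c * real j) / real q \<le> (\<mu> + 2 * \<bar>b - a\<bar> * real d) / real q"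
    if "c \<le> 2 * \<bar>b - a\<bar>" "0 \<le> c" "j < d" for c j q
    using that by (intro divide_right_mono add_left_mono mult_mono) auto
  have fB: "sum e {k0+1..k} = (\<Sum>i<k-k0. e (k0 + 1 + i))" if "k0 \<le> k"
    using sum_forward[of e k0 "k - k0"] that by simp
  have bB: "sum e {k+1..k0} = (\<Sum>i<k0-k. e (k0 - i))" if "k \<le> k0"
    using sum_backward[of "k0 - k" k0 e] that by simp
  show d1: "k < k0 + d"
  proof (rule ccontr)
    assume "\<not> k < k0 + d"
    then have kd: "k0 + d \<le> k" by simp
    have "k \<noteq> k0" using kd \<open>1 \<le> d\<close> by simp
    have U: "{1..k0} \<union> {k0+1..k} = {1..k}" "{k0+1..k} \<union> {k+1..n} = {k0+1..n}"
      using kd k1 by auto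
    have "block_rss y {1..k0} + block_rss y ({k0+1..k} \<union> {k+1..n})
        < block_rss y ({1..k0} \<union> {k0+1..k}) + block_rss y {k+1..n}"
    proof (rule block_shift_rejected[OF _ _ _ _ _ _ _ _ _ _ \<kappa>(1,2) _ l e1])
      show "\<bar>sum e {k0+1..k}\<bar> < l * real (card {k0+1..k})"
        using tame_linear[OF right(1), of "k - k0"] fB kd k1 \<open>k \<noteq> k0\<close> by simp
      show "\<bar>sum e {k+1..n}\<bar> < l * sqrt (real (card {k+1..n}) * real (card {k0+1..k} + card {k+1..n}))"
        using tame_sqrt[OF right(2), of "n - k"] sum_backward[of "n - k" n e] kd k1 by simp
      have "\<kappa>\<^sup>2 * real k \<le> \<kappa>\<^sup>2 * real n" using k1 by (intro mult_left_mono) auto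
      then show "\<kappa>\<^sup>2 * real (card {1..k0} + card {k0+1..k}) \<le> real (card {1..k0})"
        using \<kappa>(3) kd by simp
    qed (use y1 y2 k0 k1 kd \<open>k \<noteq> k0\<close> in auto)
    then show False using min unfolding U by simp
  qed
  show d2: "k0 < k + d"
  proof (rule ccontr)
    assume "\<not> k0 < k + d"
    then have kd: "k + d \<le> k0" by simp
    have "k \<noteq> k0" using kd \<open>1 \<le> d\<close> by simp
    have U: "{k0+1..n} \<union> {k+1..k0} = {k+1..n}" "{k+1..k0} \<union> {1..k} = {1..k0}"
      using kd k0 by auto
    \<comment> \<open>Mirror image: the segment after the change is now the pure block
      \<open>A\<close>, and the blocks grow towards the beginning of the sample.\<close>
    have "block_rss y {k0+1..n} + block_rss y ({k+1..k0} \<union> {1..k})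
        < block_rss y ({k0+1..n} \<union> {k+1..k0}) + block_rss y {1..k}"
    proof (rule block_shift_rejected[OF _ _ _ _ _ _ _ _ _ _ \<kappa>(1,2) _ _ _ e2])
      show "\<bar>sum e {k+1..k0}\<bar> < l * real (card {k+1..k0})"
        using tame_linear[OF left(1), of "k0 - k"] bB kd k1 \<open>k \<noteq> k0\<close> by simp
      show "\<bar>sum e {1..k}\<bar> < l * sqrt (real (card {1..k}) * real (card {k+1..k0} + card {1..k}))"
        using tame_sqrt[OF left(2), of k] sum_forward[of e 0 k] kd k1 by simp
      have "\<kappa>\<^sup>2 * real (n - k) \<le> \<kappa>\<^sup>2 * real n" by (intro mult_left_mono) auto
      then show "\<kappa>\<^sup>2 * real (card {k0+1..n} + card {k+1..k0}) \<le> real (card {k0+1..n})"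
        using \<kappa>(4) kd k0 by (simp add: of_nat_diff)
      show "l = \<kappa> / 5 * \<bar>b - a\<bar>" using l(1) by (simp add: abs_minus_commute)
    qed (use y1 y2 k0 k1 kd l \<open>k \<noteq> k0\<close> in auto)
    then show False using min unfolding U by simp
  qed
  show "\<bar>block_mean y {1..k} - a - sum e {1..k0} / real k0\<bar> \<le> (\<mu> + 2 * \<bar>b - a\<bar> * real d) / real k"
  proof (cases "k0 \<le> k")
    case True
    then have U: "{1..k0} \<union> {k0+1..k} = {1..k}" by auto
    have "\<bar>sum e {k0+1..k}\<bar> \<le> \<mu>"
      using tame_near[OF right(1), of "k - k0"] fB d1 True k1 \<open>0 < \<mu>\<close> by simp
    from block_mean_extend[OF _ _ _ _ y1 y2 e12(1) this] k0 k1 True U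
    have "\<bar>block_mean y {1..k} - a - sum e {1..k0} / real k0\<bar>
        \<le> (\<mu> + (l + \<bar>b - a\<bar>) * real (k - k0)) / real k"
      by auto
    also have "\<dots> \<le> (\<mu> + 2 * \<bar>b - a\<bar> * real d) / real k"
      using ll d1 True k0 by (intro upper) auto
    finally show ?thesis .
  next
    case False
    then have U: "{1..k0} - {k+1..k0} = {1..k}" by auto
    have "\<bar>sum e {k+1..k0}\<bar> \<le> \<mu>"
      using tame_near[OF left(1), of "k0 - k"] bB d2 False k1 \<open>0 < \<mu>\<close> by simp
    from block_mean_shrink[OF _ _ y1 e12(1) this] k0 k1 False U
    have "\<bar>block_mean y {1..k} - a - sum e {1..k0} / real k0\<bar>
        \<le> (\<mu> + l * real (k0 - k)) / real k"
      by (auto simp: psubset_eq)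
    also have "\<dots> \<le> (\<mu> + 2 * \<bar>b - a\<bar> * real d) / real k"
      using ll d2 False k1 by (intro upper) auto
    finally show ?thesis .
  qed
  show "\<bar>block_mean y {k+1..n} - b - sum e {k0+1..n} / (real n - real k0)\<bar>
           \<le> (\<mu> + 2 * \<bar>b - a\<bar> * real d) / (real n - real k)"
  proof (cases "k \<le> k0")
    case True
    then have U: "{k0+1..n} \<union> {k+1..k0} = {k+1..n}" using k0 by auto
    have "\<bar>sum e {k+1..k0}\<bar> \<le> \<mu>"
      using tame_near[OF left(1), of "k0 - k"] bB d2 True k1 \<open>0 < \<mu>\<close> by simp
    from block_mean_extend[OF _ _ _ _ y2 y1 e12(2) this] k0 k1 True U
    have "\<bar>block_mean y {k+1..n} - b - sum e {k0+1..n} / (real n - real k0)\<bar>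
        \<le> (\<mu> + (l + \<bar>a - b\<bar>) * real (k0 - k)) / real (n - k)"
      by (auto simp: of_nat_diff)
    also have "\<dots> \<le> (\<mu> + 2 * \<bar>b - a\<bar> * real d) / real (n - k)"
      using ll d2 True k1 by (intro upper) (auto simp: abs_minus_commute[of a b])
    finally show ?thesis using k1 by (simp add: of_nat_diff)
  next
    case False
    then have U: "{k0+1..n} - {k0+1..k} = {k+1..n}" using k0 by auto
    have "\<bar>sum e {k0+1..k}\<bar> \<le> \<mu>"
      using tame_near[OF right(1), of "k - k0"] fB d1 False k1 \<open>0 < \<mu>\<close> by simp
    from block_mean_shrink[OF _ _ y2 e12(2) this] k0 k1 False U
    have "\<bar>block_mean y {k+1..n} - b - sum e {k0+1..n} / (real n - real k0)\<bar>
        \<le> (\<mu> + l * real (k - k0)) / real (n - k)"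
      by (auto simp: psubset_eq of_nat_diff)
    also have "\<dots> \<le> (\<mu> + 2 * \<bar>b - a\<bar> * real d) / real (n - k)"
      using ll d1 False k1 by (intro upper) auto
    finally show ?thesis using k1 by (simp add: of_nat_diff)
  qed
qed

section \<open>Probability of the noise bounds\<close>

lemma sum_inverse_le_ln:
  assumes "1 \<le> m"
  shows "(\<Sum>k=1..m. (1 / sqrt (real k))\<^sup>2) \<le> 1 + ln (real m)"
  using assms
proof (induction m rule: dec_induct)
  case (step m)
  then have "ln (real m / real (Suc m)) \<le> real m / real (Suc m) - 1"
    by (intro ln_le_minus_one) simp
  then have "1 / real (Suc m) \<le> ln (real (Suc m)) - ln (real m)"
    using step by (simp add: ln_div field_simps)
  then show ?case using step by (simp add: power_divide)
qed simp

text \<open>Truncation at \<open>d\<close> is what yields order \<open>1 / d\<close> instead of a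
  constant: the first \<open>d\<close> terms add up to \<open>1 / d\<close>, and the tail telescopes
  by \<open>1 / (k + 1)\<^sup>2 \<le> 1 / k - 1 / (k + 1)\<close>. The induction has to keep the
  remainder \<open>1 / m\<close>.\<close>

lemma sum_truncated_inverse_squares_le:
  assumes "1 \<le> d"
  shows "(\<Sum>k=1..m. (1 / real (max d k))\<^sup>2) \<le> 2 / real d"
proof -
  have "(\<Sum>k=1..m. (1 / real (max d k))\<^sup>2) \<le> (if m \<le> d then real m / (real d)\<^sup>2 else 2 / real d - 1 / real m)"
  proof (induction m)
    case (Suc m)
    consider "Suc m \<le> d" | "m = d" | "d < m" by linarith
    then show ?case
    proof cases
      case 1
      then show ?thesis using Suc by (simp add: max_absorb1 add_divide_distrib power_divide)
    next
      case 2
      have "1 / (real (Suc d))\<^sup>2 \<le> 1 / real d - 1 / real (Suc d)"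
        using assms by (simp add: divide_simps power2_eq_square)
      then show ?thesis
        using 2 Suc assms by (simp add: max_absorb2 power_divide power2_eq_square)
    next
      case 3
      have "1 / (real (Suc m))\<^sup>2 \<le> 1 / real m - 1 / real (Suc m)"
        using assms 3 by (simp add: divide_simps power2_eq_square)
      then show ?thesis
        using 3 Suc by (simp add: max_absorb2 power_divide)
    qed
  qed simp
  also have "\<dots> \<le> 2 / real d"
    using assms by (auto simp: divide_simps power2_eq_square)
  finally show ?thesis .
qed

lemma sets_not_tame [measurable]:
  assumes "\<And>i. i < m \<Longrightarrow> (\<lambda>\<omega>. x i \<omega>) \<in> borel_measurable M"
  shows "{\<omega>\<in>space M. \<not> tame m d l \<mu> (\<lambda>i. x i \<omega>)} \<in> sets M"
proof -
  have [measurable]: "(\<lambda>\<omega>. \<Sum>i<k. x i \<omega>) \<in> borel_measurable M" if "k \<in> {1..m}" for k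
    using that assms by (intro borel_measurable_sum) auto
  show ?thesis unfolding tame_def by measurable
qed

text \<open>Three uses of \<open>hajek_renyi\<close>, one for each clause of \<open>tame\<close>:
  weights \<open>1 / sqrt k\<close> at level \<open>l * sqrt m\<close>, weights
  \<open>1 / max d k\<close> at level \<open>l\<close>, and the indicator of \<open>k < d\<close> at
  level \<open>\<mu>\<close>, which is Kolmogorov's inequality. The sums of squared weights are at
  most \<open>1 + ln m\<close>, \<open>2 / d\<close> and \<open>d\<close>.\<close>

lemma (in prob_space) prob_not_tame_le:
  fixes X :: "nat \<Rightarrow> 'a \<Rightarrow> real"
  assumes ind: "indep_vars (\<lambda>_. borel) X {..<m}"
    and int2: "\<And>i. i < m \<Longrightarrow> integrable M (\<lambda>\<omega>. (X i \<omega>)\<^sup>2)"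
    and mean: "\<And>i. i < m \<Longrightarrow> expectation (X i) = 0"
    and var: "\<And>i. i < m \<Longrightarrow> expectation (\<lambda>\<omega>. (X i \<omega>)\<^sup>2) \<le> v"
    and pos: "1 \<le> m" "1 \<le> d" "0 < l" "0 < \<mu>"
  shows "prob {\<omega>\<in>space M. \<not> tame m d l \<mu> (\<lambda>i. X i \<omega>)}
    \<le> v * ((1 + ln (real m)) / (l\<^sup>2 * real m) + 2 / (l\<^sup>2 * real d) + real d / \<mu>\<^sup>2)"
proof -
  have meas: "random_variable borel (X i)" if "i < m" for i
    using ind that by (auto simp: indep_vars_def)
  have mS [measurable]: "random_variable borel (\<lambda>\<omega>. \<Sum>i<k. X i \<omega>)" if "k \<in> {1..m}" for k
    using that meas by (intro borel_measurable_sum) auto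
  have v: "0 \<le> v"
    using var[of 0] pos by (intro order_trans[OF _ var[of 0]]) auto
  define E where "E c t = {\<omega>\<in>space M. \<exists>k\<in>{1..m}. t \<le> c k * \<bar>\<Sum>i<k. X i \<omega>\<bar>}" for c t
  have [measurable]: "E c t \<in> events" for c t
    unfolding E_def by measurable
  have sub: "{\<omega>\<in>space M. \<not> tame m d l \<mu> (\<lambda>i. X i \<omega>)}
      \<subseteq> E (\<lambda>k. 1 / sqrt (real k)) (l * sqrt (real m)) \<union> E (\<lambda>k. 1 / real (max d k)) l \<union> E (\<lambda>k. of_bool (k < d)) \<mu>"
  proof
    fix \<omega> assume "\<omega> \<in> {\<omega>\<in>space M. \<not> tame m d l \<mu> (\<lambda>i. X i \<omega>)}"
    then obtain k where w: "\<omega> \<in> space M" and k: "k \<in> {1..m}" and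
      "l * sqrt (real k * real m) \<le> \<bar>\<Sum>i<k. X i \<omega>\<bar> \<or> l * real (max d k) \<le> \<bar>\<Sum>i<k. X i \<omega>\<bar>
       \<or> k < d \<and> \<mu> \<le> \<bar>\<Sum>i<k. X i \<omega>\<bar>"
      by (auto simp: tame_def not_less)
    then consider "l * sqrt (real m) \<le> 1 / sqrt (real k) * \<bar>\<Sum>i<k. X i \<omega>\<bar>"
      | "l \<le> 1 / real (max d k) * \<bar>\<Sum>i<k. X i \<omega>\<bar>" | "\<mu> \<le> of_bool (k < d) * \<bar>\<Sum>i<k. X i \<omega>\<bar>"
      using pos by (auto simp: real_sqrt_mult field_simps)
    then show "\<omega> \<in> E (\<lambda>k. 1 / sqrt (real k)) (l * sqrt (real m)) \<union> E (\<lambda>k. 1 / real (max d k)) l \<union> E (\<lambda>k. of_bool (k < d)) \<mu>"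
      unfolding E_def using w k by cases blast+
  qed
  have "prob {\<omega>\<in>space M. \<not> tame m d l \<mu> (\<lambda>i. X i \<omega>)}
      \<le> prob (E (\<lambda>k. 1 / sqrt (real k)) (l * sqrt (real m)) \<union> E (\<lambda>k. 1 / real (max d k)) l \<union> E (\<lambda>k. of_bool (k < d)) \<mu>)"
    by (rule finite_measure_mono[OF sub]) measurable
  also have "\<dots> \<le> prob (E (\<lambda>k. 1 / sqrt (real k)) (l * sqrt (real m))) + prob (E (\<lambda>k. 1 / real (max d k)) l) + prob (E (\<lambda>k. of_bool (k < d)) \<mu>)"
    by (intro order_trans[OF measure_Un_le] add_right_mono measure_Un_le) measurable
  also have "prob (E (\<lambda>k. 1 / sqrt (real k)) (l * sqrt (real m))) \<le> v * (1 + ln (real m)) / (l * sqrt (real m))\<^sup>2"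
  proof -
    have "prob (E (\<lambda>k. 1 / sqrt (real k)) (l * sqrt (real m)))
        \<le> v * (\<Sum>k=1..m. (1 / sqrt (real k))\<^sup>2) / (l * sqrt (real m))\<^sup>2"
      unfolding E_def using pos
      by (intro hajek_renyi[OF ind int2 mean var]) (auto simp: divide_simps)
    also have "\<dots> \<le> v * (1 + ln (real m)) / (l * sqrt (real m))\<^sup>2"
      using v sum_inverse_le_ln[OF pos(1)] by (intro divide_right_mono mult_left_mono) auto
    finally show ?thesis .
  qed
  also have "prob (E (\<lambda>k. 1 / real (max d k)) l) \<le> v * (2 / real d) / l\<^sup>2"
  proof -
    have "prob (E (\<lambda>k. 1 / real (max d k)) l) \<le> v * (\<Sum>k=1..m. (1 / real (max d k))\<^sup>2) / l\<^sup>2"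
      unfolding E_def using pos
      by (intro hajek_renyi[OF ind int2 mean var]) (auto intro!: divide_left_mono mult_pos_pos simp del: of_nat_max simp: max_def)
    also have "\<dots> \<le> v * (2 / real d) / l\<^sup>2"
      using v sum_truncated_inverse_squares_le[OF pos(2)] by (intro divide_right_mono mult_left_mono) auto
    finally show ?thesis .
  qed
  also have "prob (E (\<lambda>k. of_bool (k < d)) \<mu>) \<le> v * real d / \<mu>\<^sup>2"
  proof -
    have "prob (E (\<lambda>k. of_bool (k < d)) \<mu>) \<le> v * (\<Sum>k=1..m. (of_bool (k < d))\<^sup>2) / \<mu>\<^sup>2"
      unfolding E_def using pos
      by (intro hajek_renyi[OF ind int2 mean var]) auto
    also have "(\<Sum>k=1..m. (of_bool (k < d))\<^sup>2) = real (card ({1..m} \<inter> {k. k < d}))"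
      by (subst real_of_card, rule sum.mono_neutral_cong_right) auto
    also have "\<dots> \<le> real d"
      using card_mono[of "{..<d}" "{1..m} \<inter> {k. k < d}"] by auto
    finally show ?thesis using v by (simp add: divide_right_mono mult_left_mono)
  qed
  finally show ?thesis
    using pos by (simp add: field_simps)
qed

section \<open>Weak convergence\<close>

lemma bounded_continuous_integrable:
  fixes f :: "'b::euclidean_space \<Rightarrow> real"
  assumes "prob_space M" "continuous_on UNIV f" "\<And>x. \<bar>f x\<bar> \<le> B" "Y \<in> borel_measurable M"
  shows "integrable M (\<lambda>\<omega>. f (Y \<omega>))"
proof -
  interpret prob_space M by fact
  have "f \<in> borel_measurable borel"
    using assms(2) by (rule borel_measurable_continuous_onI)
  then show ?thesis
    using assms(3,4) by (intro integrable_const_bound[of _ B]) auto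
qed

text \<open>A continuous ramp \<open>g R\<close> lies above the indicator of norm at least
  \<open>R + 1\<close>. Its integral under \<open>L\<close> is small for large \<open>R\<close>, and
  with \<open>R\<close> fixed weak convergence carries this over to \<open>U n\<close>.\<close>

lemma converges_in_distribution_tight:
  fixes U :: "nat \<Rightarrow> 'a \<Rightarrow> 'b::euclidean_space"
  assumes "prob_space M" "prob_space L" "sets L = sets borel"
    and U: "converges_in_distribution M U L" and "0 < \<epsilon>"
  obtains K where "0 \<le> K" "\<forall>\<^sub>F n in sequentially. measure M {\<omega>\<in>space M. K \<le> norm (U n \<omega>)} < \<epsilon>"
proof -
  interpret M: prob_space M by fact
  interpret L: prob_space L by fact
  note [measurable_cong] = assms(3)
  define g :: "nat \<Rightarrow> 'b \<Rightarrow> real" where "g R x = min 1 (max 0 (norm x - real R))" for R x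
  have gc: "continuous_on UNIV (g R)" for R
    unfolding g_def by (intro continuous_intros)
  have g01: "0 \<le> g R x" "g R x \<le> 1" for R x by (auto simp: g_def)
  have gm [measurable]: "g R \<in> borel_measurable borel" for R
    using gc by (rule borel_measurable_continuous_onI)
  have "(\<lambda>R. integral\<^sup>L L (g R)) \<longlonglongrightarrow> integral\<^sup>L L (\<lambda>_. 0)"
  proof (rule integral_dominated_convergence[where w="\<lambda>_. 1"])
    show "AE x in L. (\<lambda>R. g R x) \<longlonglongrightarrow> 0"
    proof (rule AE_I2)
      fix x
      have "\<forall>\<^sub>F R in sequentially. g R x = 0"
        using eventually_ge_at_top[of "nat \<lceil>norm x\<rceil>"]
        by eventually_elim (auto simp: g_def nat_le_iff ceiling_le_iff)
      then show "(\<lambda>R. g R x) \<longlonglongrightarrow> 0" by (rule tendsto_eventually)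
    qed
  qed (use g01 in auto)
  then have "\<forall>\<^sub>F R in sequentially. integral\<^sup>L L (g R) < \<epsilon>"
    using order_tendstoD(2)[of _ 0 _ \<epsilon>] \<open>0 < \<epsilon>\<close> by simp
  then obtain R where R: "integral\<^sup>L L (g R) < \<epsilon>"
    by (auto simp: eventually_sequentially)
  have "bounded (range (g R))"
    using g01 by (auto simp: bounded_iff intro!: exI[of _ 1])
  then have "(\<lambda>n. integral\<^sup>L M (\<lambda>\<omega>. g R (U n \<omega>))) \<longlonglongrightarrow> integral\<^sup>L L (g R)"
    using U gc unfolding converges_in_distribution_def by blast
  then have "\<forall>\<^sub>F n in sequentially. integral\<^sup>L M (\<lambda>\<omega>. g R (U n \<omega>)) < \<epsilon>"
    using R by (rule order_tendstoD(2))
  moreover have "\<forall>\<^sub>F n in sequentially. U n \<in> borel_measurable M"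
    using U by (simp add: converges_in_distribution_def)
  ultimately have "\<forall>\<^sub>F n in sequentially. measure M {\<omega>\<in>space M. real R + 1 \<le> norm (U n \<omega>)} < \<epsilon>"
  proof eventually_elim
    case (elim n)
    note [measurable] = elim(2)
    let ?A = "{\<omega>\<in>space M. real R + 1 \<le> norm (U n \<omega>)}"
    have [measurable]: "?A \<in> sets M" by measurable
    have "measure M ?A = integral\<^sup>L M (indicator ?A)" by simp
    also have "\<dots> \<le> integral\<^sup>L M (\<lambda>\<omega>. g R (U n \<omega>))"
    proof (rule integral_mono)
      show "integrable M (\<lambda>\<omega>. g R (U n \<omega>))"
        using g01 by (intro bounded_continuous_integrable[OF assms(1) gc, of R 1]) auto
      show "integrable M (indicator ?A :: 'a \<Rightarrow> real)"
        by (intro integrable_real_indicator) (auto simp: M.emeasure_eq_measure)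
    qed (auto simp: g_def indicator_def)
    finally show ?case using elim(1) by simp
  qed
  then show thesis by (intro that[of "real R + 1"]) auto
qed

text \<open>A bounded continuous \<open>f\<close> is uniformly continuous only on compact sets, so
  tightness is used to confine \<open>U n\<close> to a ball.\<close>

theorem converges_in_distribution_slutsky:
  fixes U V :: "nat \<Rightarrow> 'a \<Rightarrow> 'b::euclidean_space"
  assumes "prob_space M" "prob_space L" "sets L = sets borel"
    and U: "converges_in_distribution M U L"
    and V: "\<forall>\<^sub>F n in sequentially. V n \<in> borel_measurable M"
    and UV: "\<And>\<epsilon>. 0 < \<epsilon> \<Longrightarrow> (\<lambda>n. measure M {\<omega>\<in>space M. \<epsilon> \<le> norm (V n \<omega> - U n \<omega>)}) \<longlonglongrightarrow> 0"
  shows "converges_in_distribution M V L"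
  unfolding converges_in_distribution_def
proof (intro conjI allI impI V)
  interpret M: prob_space M by fact
  fix f :: "'b \<Rightarrow> real" assume f: "continuous_on UNIV f" "bounded (range f)"
  then obtain B where "0 < B" and B: "\<And>x. \<bar>f x\<bar> \<le> B"
    by (auto simp: bounded_pos)
  have Um: "\<forall>\<^sub>F n in sequentially. U n \<in> borel_measurable M"
    using U by (simp add: converges_in_distribution_def)
  have "(\<lambda>n. integral\<^sup>L M (\<lambda>\<omega>. f (V n \<omega>)) - integral\<^sup>L M (\<lambda>\<omega>. f (U n \<omega>))) \<longlonglongrightarrow> 0"
  proof (rule tendstoI, unfold dist_real_def)
    fix \<epsilon> :: real assume "0 < \<epsilon>"
    \<comment> \<open>The budget: \<open>\<eta>\<close> for the modulus of continuity and
      \<open>2 * B * \<eta>\<close> for each of the two exceptional events.\<close>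
    define \<eta> where "\<eta> = \<epsilon> / (1 + 4 * B)"
    have "0 < \<eta>" using \<open>0 < \<epsilon>\<close> \<open>0 < B\<close> by (simp add: \<eta>_def)
    have "\<eta> * (1 + 4 * B) = \<epsilon>" using \<open>0 < B\<close> by (simp add: \<eta>_def)
    then have "\<eta> + 2 * B * \<eta> + 2 * B * \<eta> = \<epsilon>" by (simp add: algebra_simps)
    obtain K where "0 \<le> K"
      and K: "\<forall>\<^sub>F n in sequentially. measure M {\<omega>\<in>space M. K \<le> norm (U n \<omega>)} < \<eta>"
      using converges_in_distribution_tight[OF assms(1-3) U \<open>0 < \<eta>\<close>] .
    have "uniformly_continuous_on (cball 0 (K + 1)) f"
      using f(1) by (intro compact_uniformly_continuous) (auto intro: continuous_on_subset)
    then obtain d where "0 < d" and d: "\<And>x x'. x \<in> cball 0 (K + 1) \<Longrightarrow> x' \<in> cball 0 (K + 1)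
        \<Longrightarrow> dist x' x < d \<Longrightarrow> dist (f x') (f x) < \<eta>"
      using \<open>0 < \<eta>\<close> unfolding uniformly_continuous_on_def by metis
    \<comment> \<open>The bound 1 keeps \<open>V n\<close> inside the ball of radius
      \<open>K + 1\<close> when \<open>U n\<close> has norm below \<open>K\<close>.\<close>
    define \<delta> where "\<delta> = min d 1"
    have "0 < \<delta>" using \<open>0 < d\<close> by (simp add: \<delta>_def)
    have "\<forall>\<^sub>F n in sequentially. measure M {\<omega>\<in>space M. \<delta> \<le> norm (V n \<omega> - U n \<omega>)} < \<eta>"
      using order_tendstoD(2)[OF UV[OF \<open>0 < \<delta>\<close>] \<open>0 < \<eta>\<close>] .
    with Um V K
    show "\<forall>\<^sub>F n in sequentially.
        \<bar>integral\<^sup>L M (\<lambda>\<omega>. f (V n \<omega>)) - integral\<^sup>L M (\<lambda>\<omega>. f (U n \<omega>)) - 0\<bar> < \<epsilon>"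
    proof eventually_elim
      case (elim n)
      note [measurable] = elim(1,2)
      let ?A = "{\<omega>\<in>space M. K \<le> norm (U n \<omega>)}"
      let ?D = "{\<omega>\<in>space M. \<delta> \<le> norm (V n \<omega> - U n \<omega>)}"
      have [measurable]: "?A \<in> sets M" "?D \<in> sets M" by measurable
      have ind: "integrable M (indicator ?A :: 'a \<Rightarrow> real)" "integrable M (indicator ?D :: 'a \<Rightarrow> real)"
        by (auto intro!: integrable_real_indicator simp: M.emeasure_eq_measure)
      have int: "integrable M (\<lambda>\<omega>. f (V n \<omega>))" "integrable M (\<lambda>\<omega>. f (U n \<omega>))"
        using bounded_continuous_integrable[OF assms(1) f(1) B] elim by auto
      have "\<bar>integral\<^sup>L M (\<lambda>\<omega>. f (V n \<omega>)) - integral\<^sup>L M (\<lambda>\<omega>. f (U n \<omega>))\<bar>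
          = \<bar>integral\<^sup>L M (\<lambda>\<omega>. f (V n \<omega>) - f (U n \<omega>))\<bar>"
        using int by simp
      also have "\<dots> \<le> integral\<^sup>L M (\<lambda>\<omega>. \<bar>f (V n \<omega>) - f (U n \<omega>)\<bar>)"
        by (rule integral_abs_bound)
      also have "\<dots> \<le> integral\<^sup>L M (\<lambda>\<omega>. \<eta> + 2 * B * indicator ?A \<omega> + 2 * B * indicator ?D \<omega>)"
      proof (rule integral_mono)
        fix \<omega> assume w: "\<omega> \<in> space M"
        have le: "\<bar>f (V n \<omega>) - f (U n \<omega>)\<bar> \<le> 2 * B"
          using B[of "V n \<omega>"] B[of "U n \<omega>"] by linarith
        show "\<bar>f (V n \<omega>) - f (U n \<omega>)\<bar> \<le> \<eta> + 2 * B * indicator ?A \<omega> + 2 * B * indicator ?D \<omega>"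
        proof (cases "\<omega> \<in> ?A \<or> \<omega> \<in> ?D")
          case True
          then show ?thesis using le \<open>0 < \<eta>\<close> \<open>0 < B\<close> by (auto simp: indicator_def)
        next
          case False
          then have "norm (U n \<omega>) < K" "norm (V n \<omega> - U n \<omega>) < \<delta>" using w by auto
          then have "norm (V n \<omega>) \<le> K + 1"
            using norm_triangle_sub[of "V n \<omega>" "U n \<omega>"] by (simp add: \<delta>_def)
          then have "dist (f (V n \<omega>)) (f (U n \<omega>)) < \<eta>"
            using \<open>norm (U n \<omega>) < K\<close> \<open>norm (V n \<omega> - U n \<omega>) < \<delta>\<close>
            by (intro d) (auto simp: \<delta>_def dist_norm)
          then show ?thesis using False by (simp add: dist_real_def)
        qed
      qed (use int ind in auto)
      also have "\<dots> = \<eta> + 2 * B * measure M ?A + 2 * B * measure M ?D"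
        using ind by (simp add: M.prob_space)
      also have "\<dots> < \<eta> + 2 * B * \<eta> + 2 * B * \<eta>"
        using elim(3,4) \<open>0 < B\<close> by (intro add_strict_mono add_strict_left_mono mult_strict_left_mono) auto
      finally show ?case using \<open>\<eta> + 2 * B * \<eta> + 2 * B * \<eta> = \<epsilon>\<close> by simp
    qed
  qed
  moreover have "(\<lambda>n. integral\<^sup>L M (\<lambda>\<omega>. f (U n \<omega>))) \<longlonglongrightarrow> integral\<^sup>L L f"
    using U f by (auto simp: converges_in_distribution_def)
  ultimately have "(\<lambda>n. (integral\<^sup>L M (\<lambda>\<omega>. f (V n \<omega>)) - integral\<^sup>L M (\<lambda>\<omega>. f (U n \<omega>)))
      + integral\<^sup>L M (\<lambda>\<omega>. f (U n \<omega>))) \<longlonglongrightarrow> 0 + integral\<^sup>L L f"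
    by (rule tendsto_add)
  then show "(\<lambda>n. integral\<^sup>L M (\<lambda>\<omega>. f (V n \<omega>))) \<longlonglongrightarrow> integral\<^sup>L L f"
    by simp
qed

section \<open>Bivariate normal laws with diagonal covariance\<close>

lemma vector_2_expand: "(vector [x, y] :: real^2) = x *\<^sub>R axis 1 1 + y *\<^sub>R axis 2 1"
  by (simp add: vec_eq_iff forall_2 axis_def)

lemma borel_measurable_vector_2 [measurable (raw)]:
  assumes [measurable]: "f \<in> borel_measurable M" "g \<in> borel_measurable M"
  shows "(\<lambda>x. vector [f x, g x] :: real^2) \<in> borel_measurable M"
  unfolding vector_2_expand by measurable

lemma Basis_vec_2: "(Basis :: (real^2) set) = {axis 1 1, axis 2 1}"
  by (auto simp: Basis_vec_def UNIV_2)

text \<open>Lebesgue measure is determined by open boxes, and these pull back to rectangles.\<close>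

lemma lborel_vector_2:
  "distr (lborel \<Otimes>\<^sub>M lborel) borel (\<lambda>(x, y). vector [x, y] :: real^2) = lborel"
proof (rule lborel_eqI[symmetric])
  fix l u :: "real^2" assume lu: "\<And>b. b \<in> Basis \<Longrightarrow> l \<bullet> b \<le> u \<bullet> b"
  have lu': "l $ 1 \<le> u $ 1" "l $ 2 \<le> u $ 2"
    using lu[of "axis 1 1"] lu[of "axis 2 1"] by (auto simp: Basis_vec_2 inner_axis)
  have *: "(\<lambda>(x, y). vector [x, y] :: real^2) -` box l u \<inter> space (lborel \<Otimes>\<^sub>M lborel)
      = {l$1<..<u$1} \<times> {l$2<..<u$2}"
    by (auto simp: space_pair_measure mem_box_cart forall_2)
  have "emeasure (distr (lborel \<Otimes>\<^sub>M lborel) borel (\<lambda>(x, y). vector [x, y])) (box l u)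
      = emeasure lborel {l$1<..<u$1} * emeasure lborel {l$2<..<u$2}"
    using *
    by (subst emeasure_distr) (auto simp: lborel.emeasure_pair_measure_Times split_beta')
  also have "\<dots> = ennreal (\<Prod>b\<in>Basis. (u - l) \<bullet> b)"
    using lu' by (simp add: Basis_vec_2 axis_eq_axis inner_axis ennreal_mult inner_diff_left)
  finally show "emeasure (distr (lborel \<Otimes>\<^sub>M lborel) borel (\<lambda>(x, y). vector [x, y])) (box l u)
      = ennreal (\<Prod>b\<in>Basis. (u - l) \<bullet> b)" .
qed simp

text \<open>\<open>matrix_inv\<close> is a choice among two-sided inverses, so it is identified by
  multiplying with an explicit one.\<close>

lemma matrix_inv_diag_2:
  fixes p q :: real
  assumes "p \<noteq> 0" "q \<noteq> 0"
  shows "matrix_inv (vector [vector [p, 0], vector [0, q]] :: real^2^2)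
    = vector [vector [1 / p, 0], vector [0, 1 / q]]" (is "matrix_inv ?A = ?B")
proof -
  have AB: "?A ** ?B = mat 1" "?B ** ?A = mat 1"
    using assms by (simp_all add: vec_eq_iff forall_2 matrix_matrix_mult_def sum_2 mat_def)
  then have "?A ** matrix_inv ?A = mat 1"
    unfolding matrix_inv_def by (metis (mono_tags, lifting) someI_ex)
  then have "?B ** (?A ** matrix_inv ?A) = ?B" by simp
  then show ?thesis using AB by (simp add: matrix_mul_assoc)
qed

lemma normal_density_scaled:
  assumes "0 < a"
  shows "distr std_normal_distribution borel (\<lambda>x. a * x) = density lborel (normal_density 0 a)"
proof -
  interpret prob_space std_normal_distribution
    by (rule prob_space_normal_density) simp
  have "distributed std_normal_distribution lborel (\<lambda>x. x) std_normal_density"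
    by (simp add: distributed_def distr_id2)
  from normal_density_affine[OF this, of a 0] assms
  have "distributed std_normal_distribution lborel (\<lambda>x. a * x) (normal_density 0 a)" by simp
  then have "density lborel (normal_density 0 a) = distr std_normal_distribution lborel (\<lambda>x. a * x)"
    by (simp add: distributed_def)
  also have "\<dots> = distr std_normal_distribution borel (\<lambda>x. a * x)"
    by (rule distr_cong) auto
  finally show ?thesis by simp
qed

text \<open>For a diagonal matrix the quadratic form splits and the determinant factors, so the
  density is a product. This links the density that defines the limit with the image of a product
  measure that the coupling argument produces.\<close>

lemma multivariate_normal_diag_2:
  assumes a: "0 < a" and b: "0 < b"
  shows "distr (std_normal_distribution \<Otimes>\<^sub>M std_normal_distribution) borel
      (\<lambda>(x, y). vector [a * x, b * y] :: real^2)
    = multivariate_normal 0 (vector [vector [a\<^sup>2, 0], vector [0, b\<^sup>2]])"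
proof -
  let ?\<Sigma> = "vector [vector [a\<^sup>2, 0], vector [0, b\<^sup>2]] :: real^2^2"
  let ?v = "\<lambda>(x, y). vector [x, y] :: real^2"
  let ?N = "std_normal_distribution"
  interpret prob_space ?N
    by (rule prob_space_normal_density) simp
  have dens: "multivariate_normal_density 0 ?\<Sigma> (vector [x, y])
      = normal_density 0 a x * normal_density 0 b y" for x y
  proof -
    have "sqrt ((2 * pi)\<^sup>2 * (a\<^sup>2 * b\<^sup>2)) = sqrt (2 * pi * a\<^sup>2) * sqrt (2 * pi * b\<^sup>2)"
      by (simp add: power2_eq_square flip: real_sqrt_mult)
    moreover have "vector [x, y] \<bullet> (matrix_inv ?\<Sigma> *v (vector [x, y] :: real^2)) = x\<^sup>2 / a\<^sup>2 + y\<^sup>2 / b\<^sup>2"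
      using a b by (simp add: matrix_inv_diag_2 inner_vec_def sum_2 matrix_vector_mult_def power2_eq_square)
    ultimately show ?thesis
      using a b unfolding multivariate_normal_density_def normal_density_def
      by (simp add: det_2 exp_add[symmetric] add_divide_distrib)
  qed
  have cont: "continuous_on UNIV (multivariate_normal_density 0 ?\<Sigma>)"
    unfolding multivariate_normal_density_def using a b
    by (intro continuous_intros linear_continuous_on matrix_vector_mul_bounded_linear) (auto simp: det_2)
  have "distr (?N \<Otimes>\<^sub>M ?N) borel (\<lambda>(x, y). vector [a * x, b * y] :: real^2)
      = distr (distr (?N \<Otimes>\<^sub>M ?N) (borel \<Otimes>\<^sub>M borel) (\<lambda>(x, y). (a * x, b * y))) borel ?v"
    by (subst distr_distr) (auto simp: o_def split_beta')
  also have "distr (?N \<Otimes>\<^sub>M ?N) (borel \<Otimes>\<^sub>M borel) (\<lambda>(x, y). (a * x, b * y))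
      = distr ?N borel (\<lambda>x. a * x) \<Otimes>\<^sub>M distr ?N borel (\<lambda>x. b * x)"
    by (rule pair_measure_distr[symmetric])
      (auto intro!: prob_space_imp_sigma_finite prob_space_distr)
  also have "\<dots> = density lborel (normal_density 0 a) \<Otimes>\<^sub>M density lborel (normal_density 0 b)"
    using a b by (simp add: normal_density_scaled)
  also have "\<dots> = density (lborel \<Otimes>\<^sub>M lborel) (\<lambda>(x, y). ennreal (normal_density 0 a x) * ennreal (normal_density 0 b y))"
    using b by (intro pair_measure_density)
      (auto intro!: prob_space_imp_sigma_finite prob_space_normal_density simp: lborel.sigma_finite_measure_axioms)
  also have "\<dots> = density (lborel \<Otimes>\<^sub>M lborel) (\<lambda>p. ennreal (multivariate_normal_density 0 ?\<Sigma> (?v p)))"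
    by (intro density_cong) (auto simp: dens ennreal_mult split_beta')
  also have "distr \<dots> borel ?v = density (distr (lborel \<Otimes>\<^sub>M lborel) borel ?v) (\<lambda>z. ennreal (multivariate_normal_density 0 ?\<Sigma> z))"
    using borel_measurable_continuous_onI[OF cont]
    by (intro density_distr[symmetric]) (auto simp: split_beta')
  also have "\<dots> = multivariate_normal 0 ?\<Sigma>"
    by (simp add: lborel_vector_2 multivariate_normal_def)
  finally show ?thesis .
qed

text \<open>Skorohod couplings of the two coordinates on a product space turn joint weak convergence
  into pointwise convergence.\<close>

lemma converges_in_distribution_indep_pair:
  fixes \<mu> :: "nat \<Rightarrow> real measure" and A B :: "nat \<Rightarrow> 'a \<Rightarrow> real"
  assumes "prob_space M" and \<mu>: "\<And>n. real_distribution (\<mu> n)" and L: "real_distribution L"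
    and weak: "weak_conv_m \<mu> L"
    and p: "filterlim p at_top sequentially" and q: "filterlim q at_top sequentially"
    and a: "a \<longlonglongrightarrow> \<alpha>" and b: "b \<longlonglongrightarrow> \<beta>"
    and ind: "\<forall>\<^sub>F n in sequentially. prob_space.indep_var M borel (A n) borel (B n)"
    and A: "\<forall>\<^sub>F n in sequentially. distr M borel (A n) = \<mu> (p n)"
    and B: "\<forall>\<^sub>F n in sequentially. distr M borel (B n) = \<mu> (q n)"
  shows "converges_in_distribution M (\<lambda>n \<omega>. vector [a n * A n \<omega>, b n * B n \<omega>] :: real^2)
    (distr (L \<Otimes>\<^sub>M L) borel (\<lambda>(x, y). vector [\<alpha> * x, \<beta> * y]))"
  unfolding converges_in_distribution_def
proof (intro conjI allI impI)
  interpret prob_space M by fact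
  have rv: "\<forall>\<^sub>F n in sequentially. A n \<in> borel_measurable M \<and> B n \<in> borel_measurable M"
    using ind by eventually_elim (auto dest: indep_var_rv1 indep_var_rv2)
  then show "\<forall>\<^sub>F n in sequentially. (\<lambda>\<omega>. vector [a n * A n \<omega>, b n * B n \<omega>] :: real^2) \<in> borel_measurable M"
    by eventually_elim (auto intro!: borel_measurable_vector_2)
  fix f :: "real^2 \<Rightarrow> real" assume f: "continuous_on UNIV f" "bounded (range f)"
  have fm [measurable]: "f \<in> borel_measurable borel"
    using f(1) by (rule borel_measurable_continuous_onI)
  obtain C where C: "\<And>x. \<bar>f x\<bar> \<le> C"
    using f(2) by (auto simp: bounded_iff)
  from Skorohod[OF \<mu> L weak]
  obtain \<Omega> :: "real measure" and Y_seq Y where "prob_space \<Omega>"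
    and Yn [measurable]: "\<And>n. Y_seq n \<in> borel_measurable \<Omega>" and Yn_law: "\<And>n. distr \<Omega> borel (Y_seq n) = \<mu> n"
    and Y: "Y \<in> measurable \<Omega> lborel" and Y_law: "distr \<Omega> borel Y = L"
    and conv: "\<And>x. x \<in> space \<Omega> \<Longrightarrow> (\<lambda>n. Y_seq n x) \<longlonglongrightarrow> Y x"
    by blast
  interpret \<Omega>: prob_space \<Omega> by fact
  interpret P: pair_prob_space \<Omega> \<Omega> ..
  have [measurable]: "Y \<in> borel_measurable \<Omega>" using Y by simp
  \<comment> \<open>The same coupling is used in both coordinates of
    \<open>\<Omega> \<times> \<Omega>\<close>, at the positions \<open>p n\<close> and
    \<open>q n\<close>. The product supplies the independence, so \<open>A n\<close> and
    \<open>B n\<close> need to be matched in law only.\<close>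
  define g where "g n z = f (vector [a n * Y_seq (p n) (fst z), b n * Y_seq (q n) (snd z)])" for n z
  have coupling: "integral\<^sup>L M (\<lambda>\<omega>. f (vector [a n * A n \<omega>, b n * B n \<omega>])) = integral\<^sup>L (\<Omega> \<Otimes>\<^sub>M \<Omega>) (g n)"
    if n: "indep_var borel (A n) borel (B n)" "distr M borel (A n) = \<mu> (p n)" "distr M borel (B n) = \<mu> (q n)" for n
  proof -
    have [measurable]: "A n \<in> borel_measurable M" "B n \<in> borel_measurable M"
      using n by (auto dest: indep_var_rv1 indep_var_rv2)
    have "distr M (borel \<Otimes>\<^sub>M borel) (\<lambda>\<omega>. (A n \<omega>, B n \<omega>)) = \<mu> (p n) \<Otimes>\<^sub>M \<mu> (q n)"
      using n by (simp add: indep_var_distribution_eq)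
    also have "\<dots> = distr \<Omega> borel (Y_seq (p n)) \<Otimes>\<^sub>M distr \<Omega> borel (Y_seq (q n))"
      by (simp add: Yn_law)
    also have "\<dots> = distr (\<Omega> \<Otimes>\<^sub>M \<Omega>) (borel \<Otimes>\<^sub>M borel) (\<lambda>(x, y). (Y_seq (p n) x, Y_seq (q n) y))"
      by (intro pair_measure_distr Yn prob_space_imp_sigma_finite \<Omega>.prob_space_distr)
    finally have law: "distr M (borel \<Otimes>\<^sub>M borel) (\<lambda>\<omega>. (A n \<omega>, B n \<omega>))
      = distr (\<Omega> \<Otimes>\<^sub>M \<Omega>) (borel \<Otimes>\<^sub>M borel) (\<lambda>(x, y). (Y_seq (p n) x, Y_seq (q n) y))" .
    let ?h = "\<lambda>z. f (vector [a n * fst z, b n * snd z])"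
    have [measurable]: "?h \<in> borel_measurable (borel \<Otimes>\<^sub>M borel)" by measurable
    have "integral\<^sup>L M (\<lambda>\<omega>. f (vector [a n * A n \<omega>, b n * B n \<omega>]))
        = integral\<^sup>L (distr M (borel \<Otimes>\<^sub>M borel) (\<lambda>\<omega>. (A n \<omega>, B n \<omega>))) ?h"
      by (subst integral_distr) auto
    also have "\<dots> = integral\<^sup>L (\<Omega> \<Otimes>\<^sub>M \<Omega>) (g n)"
      unfolding law by (subst integral_distr) (auto simp: g_def[abs_def] split_beta')
    finally show ?thesis .
  qed
  from ind A B have eq: "\<forall>\<^sub>F n in sequentially. integral\<^sup>L (\<Omega> \<Otimes>\<^sub>M \<Omega>) (g n)
      = integral\<^sup>L M (\<lambda>\<omega>. f (vector [a n * A n \<omega>, b n * B n \<omega>]))"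
    by eventually_elim (simp add: coupling)
  have "(\<lambda>n. integral\<^sup>L (\<Omega> \<Otimes>\<^sub>M \<Omega>) (g n)) \<longlonglongrightarrow>
      integral\<^sup>L (\<Omega> \<Otimes>\<^sub>M \<Omega>) (\<lambda>z. f (vector [\<alpha> * Y (fst z), \<beta> * Y (snd z)]))"
  proof (rule integral_dominated_convergence[where w="\<lambda>_. C"])
    show "AE z in \<Omega> \<Otimes>\<^sub>M \<Omega>. (\<lambda>n. g n z) \<longlonglongrightarrow> f (vector [\<alpha> * Y (fst z), \<beta> * Y (snd z)])"
    proof (rule AE_I2)
      fix z assume "z \<in> space (\<Omega> \<Otimes>\<^sub>M \<Omega>)"
      then have z: "fst z \<in> space \<Omega>" "snd z \<in> space \<Omega>" by (auto simp: space_pair_measure)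
      have "(\<lambda>n. vector [a n * Y_seq (p n) (fst z), b n * Y_seq (q n) (snd z)] :: real^2)
          \<longlonglongrightarrow> vector [\<alpha> * Y (fst z), \<beta> * Y (snd z)]"
        unfolding vector_2_expand
        by (intro tendsto_intros a b filterlim_compose[OF conv[OF z(1)] p] filterlim_compose[OF conv[OF z(2)] q])
      then show "(\<lambda>n. g n z) \<longlonglongrightarrow> f (vector [\<alpha> * Y (fst z), \<beta> * Y (snd z)])"
        unfolding g_def by (rule continuous_on_tendsto_compose[OF f(1)]) auto
    qed
    show "g n \<in> borel_measurable (\<Omega> \<Otimes>\<^sub>M \<Omega>)" for n
      unfolding g_def[abs_def] by measurable
  qed (auto simp: g_def C)
  also have "integral\<^sup>L (\<Omega> \<Otimes>\<^sub>M \<Omega>) (\<lambda>z. f (vector [\<alpha> * Y (fst z), \<beta> * Y (snd z)]))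
      = integral\<^sup>L (distr (\<Omega> \<Otimes>\<^sub>M \<Omega>) (borel \<Otimes>\<^sub>M borel) (\<lambda>(x, y). (Y x, Y y)))
          (\<lambda>z. f (vector [\<alpha> * fst z, \<beta> * snd z]))"
    by (subst integral_distr) (auto simp: split_beta')
  also have "distr (\<Omega> \<Otimes>\<^sub>M \<Omega>) (borel \<Otimes>\<^sub>M borel) (\<lambda>(x, y). (Y x, Y y)) = L \<Otimes>\<^sub>M L"
    unfolding Y_law[symmetric]
    by (intro pair_measure_distr[symmetric] prob_space_imp_sigma_finite \<Omega>.prob_space_distr) auto
  also have "integral\<^sup>L (L \<Otimes>\<^sub>M L) (\<lambda>z. f (vector [\<alpha> * fst z, \<beta> * snd z]))
      = integral\<^sup>L (distr (L \<Otimes>\<^sub>M L) borel (\<lambda>(x, y). vector [\<alpha> * x, \<beta> * y])) f"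
  proof -
    interpret L: real_distribution L by fact
    show ?thesis by (subst integral_distr) (auto simp: split_beta')
  qed
  finally show "(\<lambda>n. integral\<^sup>L M (\<lambda>\<omega>. f (vector [a n * A n \<omega>, b n * B n \<omega>]))) \<longlonglongrightarrow>
      integral\<^sup>L (distr (L \<Otimes>\<^sub>M L) borel (\<lambda>(x, y). vector [\<alpha> * x, \<beta> * y])) f"
    using eq by (rule Lim_transform_eventually)
qed

section \<open>Central limit theorem for chi-square sums\<close>

definition chi_square_sum :: "nat \<Rightarrow> (nat \<Rightarrow> real) \<Rightarrow> real" where
  "chi_square_sum m x = (\<Sum>i<m. (x i)\<^sup>2 - 1) / sqrt (real m * 2)"

text \<open>Naming the law by its length detaches it from the row of the triangular array in which
  the sum occurs.\<close>

definition chi_square_sum_law :: "nat \<Rightarrow> real measure" where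
  "chi_square_sum_law m = distr (PiM {..<m} (\<lambda>_. std_normal_distribution)) borel (chi_square_sum m)"

lemma prob_space_std_normal: "prob_space std_normal_distribution"
  by (rule prob_space_normal_density) simp

lemma borel_measurable_chi_square_sum:
  assumes "sets N = sets borel"
  shows "chi_square_sum m \<in> borel_measurable (PiM {..<m} (\<lambda>_. N))"
proof -
  note [measurable_cong] = assms
  have [measurable]: "(\<lambda>x. x i) \<in> borel_measurable (PiM {..<m} (\<lambda>_. N))" if "i < m" for i
    using measurable_component_singleton[of i "{..<m}" "\<lambda>_. N"] that
    by (simp cong: measurable_cong_sets add: assms)
  show ?thesis unfolding chi_square_sum_def by measurable
qed

lemma real_distribution_chi_square_sum_law: "real_distribution (chi_square_sum_law m)"
  unfolding chi_square_sum_law_def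
  by (intro prob_space.real_distribution_distr prob_space_PiM prob_space_std_normal
      borel_measurable_chi_square_sum) simp

lemma (in prob_space) distr_chi_square_sum:
  assumes ind: "indep_vars (\<lambda>_. borel) X {..<m}" and "1 \<le> m"
    and law: "\<And>i. i < m \<Longrightarrow> distr M borel (X i) = std_normal_distribution"
  shows "distr M borel (\<lambda>\<omega>. chi_square_sum m (\<lambda>i. X i \<omega>)) = chi_square_sum_law m"
proof -
  have rv: "random_variable borel (X i)" if "i \<in> {..<m}" for i
    using ind that by (auto simp: indep_vars_def)
  have law_PiM: "PiM {..<m} (\<lambda>i. distr M borel (X i)) = PiM {..<m} (\<lambda>_. std_normal_distribution)"
    using law by (intro PiM_cong) auto
  have eq: "distr M (PiM {..<m} (\<lambda>_. borel)) (\<lambda>\<omega>. \<lambda>i\<in>{..<m}. X i \<omega>) = PiM {..<m} (\<lambda>_. std_normal_distribution)"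
    using law_PiM indep_vars_iff_distr_eq_PiM'[where I="{..<m}" and M'="\<lambda>_. borel" and X=X] ind rv \<open>1 \<le> m\<close>
    by (auto simp: lessThan_empty_iff)
  have "distr M borel (\<lambda>\<omega>. chi_square_sum m (\<lambda>i. X i \<omega>))
      = distr M borel (chi_square_sum m \<circ> (\<lambda>\<omega>. \<lambda>i\<in>{..<m}. X i \<omega>))"
    by (intro distr_cong) (auto simp: chi_square_sum_def)
  also have "\<dots> = distr (distr M (PiM {..<m} (\<lambda>_. borel)) (\<lambda>\<omega>. \<lambda>i\<in>{..<m}. X i \<omega>)) borel (chi_square_sum m)"
    using rv by (intro distr_distr[symmetric] borel_measurable_chi_square_sum measurable_restrict) auto
  finally show ?thesis by (simp add: eq chi_square_sum_law_def)
qed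

text \<open>The fourth moment 3 gives the variance \<open>3 - 2 + 1 = 2\<close>, the origin of the
  factor 2 in the limiting covariance.\<close>

lemma std_normal_square_moments:
  shows "integrable std_normal_distribution (\<lambda>x. (x\<^sup>2 - 1)\<^sup>2)"
    and "integral\<^sup>L std_normal_distribution (\<lambda>x. x\<^sup>2 - 1) = 0"
    and "integral\<^sup>L std_normal_distribution (\<lambda>x. (x\<^sup>2 - 1)\<^sup>2) = 2"
proof -
  interpret prob_space std_normal_distribution by (rule prob_space_std_normal)
  have e: "(x\<^sup>2 - 1)\<^sup>2 = x ^ 4 - 2 * x\<^sup>2 + 1" for x :: real
    by (simp add: power2_diff power_mult[symmetric])
  note int = integrable_std_normal_distribution_moment
  have m: "integral\<^sup>L std_normal_distribution (\<lambda>x. x\<^sup>2) = 1"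
       "integral\<^sup>L std_normal_distribution (\<lambda>x. x ^ 4) = 3"
    using std_normal_distribution_even_moments(1)[of 1] std_normal_distribution_even_moments(1)[of 2]
    by (simp_all add: fact_numeral)
  show "integrable std_normal_distribution (\<lambda>x. (x\<^sup>2 - 1)\<^sup>2)"
    unfolding e using int by simp
  show "integral\<^sup>L std_normal_distribution (\<lambda>x. x\<^sup>2 - 1) = 0"
    using int m prob_space by simp
  show "integral\<^sup>L std_normal_distribution (\<lambda>x. (x\<^sup>2 - 1)\<^sup>2) = 2"
    unfolding e using int m prob_space by simp
qed

text \<open>The coordinates of an infinite product form one sequence with sums of all lengths, to
  which the classical theorem applies; \<open>distr_chi_square_sum\<close> then identifies the laws
  for positive length.\<close>

lemma weak_conv_chi_square_sum_law: "weak_conv_m chi_square_sum_law std_normal_distribution"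
proof -
  let ?P = "PiM UNIV (\<lambda>_::nat. std_normal_distribution)"
  interpret P: prob_space ?P by (intro prob_space_PiM prob_space_std_normal)
  have sets: "sets ?P = sets (PiM UNIV (\<lambda>_. borel))"
    by (intro sets_PiM_cong) auto
  have rv [measurable]: "(\<lambda>x. x i) \<in> borel_measurable ?P" for i
    using measurable_component_singleton[of i UNIV "\<lambda>_. std_normal_distribution"]
    by (simp cong: measurable_cong_sets)
  have law: "distr ?P borel (\<lambda>x. x i) = std_normal_distribution" for i
  proof -
    have "distr ?P borel (\<lambda>x. x i) = distr ?P std_normal_distribution (\<lambda>x. x i)"
      by (intro distr_cong) auto
    also have "\<dots> = std_normal_distribution"
      using distr_PiM_component[of UNIV "\<lambda>_. std_normal_distribution" i] prob_space_std_normal by blast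
    finally show ?thesis .
  qed
  have ind: "P.indep_vars (\<lambda>_. borel) (\<lambda>i x. x i) UNIV"
  proof (subst P.indep_vars_iff_distr_eq_PiM)
    have "distr ?P (PiM UNIV (\<lambda>_. borel)) (\<lambda>x. \<lambda>i\<in>UNIV. x i) = ?P"
      using distr_id2[OF sets[symmetric]] by (simp add: restrict_UNIV)
    then show "distr ?P (PiM UNIV (\<lambda>_. borel)) (\<lambda>x. \<lambda>i\<in>UNIV. x i) = PiM UNIV (\<lambda>i. distr ?P borel (\<lambda>x. x i))"
      by (simp add: law)
  qed auto
  have int: "integral\<^sup>L ?P (\<lambda>x. h (x i)) = integral\<^sup>L std_normal_distribution h"
    if "h \<in> borel_measurable borel" for h :: "real \<Rightarrow> real" and i
    using integral_distr[OF rv that, of i] by (simp add: law)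
  have "weak_conv_m (\<lambda>n. distr ?P borel (\<lambda>x. (\<Sum>i<n. (x i)\<^sup>2 - 1) / sqrt (real n * (sqrt 2)\<^sup>2))) std_normal_distribution"
  proof (rule P.central_limit_theorem_zero_mean)
    show "P.indep_vars (\<lambda>i. borel) (\<lambda>i x. (x i)\<^sup>2 - 1) UNIV"
      by (rule P.indep_vars_compose2[OF ind, of "\<lambda>_ y. y\<^sup>2 - 1"]) measurable
    show mean: "integral\<^sup>L ?P (\<lambda>x. (x n)\<^sup>2 - 1) = 0" for n
      using int[of "\<lambda>y. y\<^sup>2 - 1"] std_normal_square_moments by simp
    show "integrable ?P (\<lambda>x. ((x n)\<^sup>2 - 1)\<^sup>2)" for n
      using std_normal_square_moments(1) integrable_distr[OF rv, of n "\<lambda>y. (y\<^sup>2 - 1)\<^sup>2"] by (simp add: law)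
    show "P.variance (\<lambda>x. (x n)\<^sup>2 - 1) = (sqrt 2)\<^sup>2" for n
      using int[of "\<lambda>y. (y\<^sup>2 - 1)\<^sup>2"] std_normal_square_moments(3) by (simp add: mean)
    show "distr ?P borel (\<lambda>x. (x n)\<^sup>2 - 1) = distr std_normal_distribution borel (\<lambda>y. y\<^sup>2 - 1)" for n
    proof -
      have "distr ?P borel (\<lambda>x. (x n)\<^sup>2 - 1) = distr (distr ?P borel (\<lambda>x. x n)) borel (\<lambda>y. y\<^sup>2 - 1)"
        by (subst distr_distr) (auto simp: o_def)
      then show ?thesis by (simp only: law)
    qed
  qed simp
  moreover have "\<forall>\<^sub>F n in sequentially.
      distr ?P borel (\<lambda>x. (\<Sum>i<n. (x i)\<^sup>2 - 1) / sqrt (real n * (sqrt 2)\<^sup>2)) = chi_square_sum_law n"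
    using eventually_ge_at_top[of 1]
  proof eventually_elim
    case (elim n)
    have "P.indep_vars (\<lambda>_. borel) (\<lambda>i x. x i) {..<n}"
      by (rule P.indep_vars_subset[OF ind]) simp
    from P.distr_chi_square_sum[OF this elim law] show ?case
      by (simp add: chi_square_sum_def)
  qed
  ultimately show ?thesis
    unfolding weak_conv_m_def weak_conv_def
  proof (intro allI impI)
    fix x assume conv: "\<forall>x. isCont (cdf std_normal_distribution) x \<longrightarrow>
        (\<lambda>n. cdf (distr ?P borel (\<lambda>x. (\<Sum>i<n. (x i)\<^sup>2 - 1) / sqrt (real n * (sqrt 2)\<^sup>2))) x)
          \<longlonglongrightarrow> cdf std_normal_distribution x"
      and ev: "\<forall>\<^sub>F n in sequentially.
        distr ?P borel (\<lambda>x. (\<Sum>i<n. (x i)\<^sup>2 - 1) / sqrt (real n * (sqrt 2)\<^sup>2)) = chi_square_sum_law n"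
      and x: "isCont (cdf std_normal_distribution) x"
    show "(\<lambda>n. cdf (chi_square_sum_law n) x) \<longlonglongrightarrow> cdf std_normal_distribution x"
      using conv[rule_format, OF x]
      by (rule Lim_transform_eventually) (use ev in \<open>auto elim: eventually_mono\<close>)
  qed
qed

section \<open>The change point estimator\<close>

text \<open>Observations are numbered from 1 to \<open>n\<close> while \<open>tame\<close> reads
  from 0; the four readings start at \<open>k + 1\<close>, \<open>n\<close>, \<open>k\<close> and
  1.\<close>

definition all_tame :: "nat \<Rightarrow> nat \<Rightarrow> nat \<Rightarrow> real \<Rightarrow> real \<Rightarrow> (nat \<Rightarrow> real) \<Rightarrow> bool" where
  "all_tame n k d l \<mu> e \<longleftrightarrow>
     tame (n - k) d l \<mu> (\<lambda>j. e (k + 1 + j)) \<and> tame (n - k) d l \<mu> (\<lambda>j. e (n - j)) \<and>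
     tame k d l \<mu> (\<lambda>j. e (k - j)) \<and> tame k d l \<mu> (\<lambda>j. e (1 + j))"

lemma sets_not_all_tame [measurable]:
  assumes "\<And>i. i \<in> {1..n} \<Longrightarrow> (\<lambda>\<omega>. e i \<omega>) \<in> borel_measurable M" "k \<le> n"
  shows "{\<omega>\<in>space M. \<not> all_tame n k d l \<mu> (\<lambda>i. e i \<omega>)} \<in> sets M"
proof -
  have "{\<omega>\<in>space M. \<not> all_tame n k d l \<mu> (\<lambda>i. e i \<omega>)}
    = {\<omega>\<in>space M. \<not> tame (n - k) d l \<mu> (\<lambda>j. e (k + 1 + j) \<omega>)} \<union> {\<omega>\<in>space M. \<not> tame (n - k) d l \<mu> (\<lambda>j. e (n - j) \<omega>)}
      \<union> {\<omega>\<in>space M. \<not> tame k d l \<mu> (\<lambda>j. e (k - j) \<omega>)} \<union> {\<omega>\<in>space M. \<not> tame k d l \<mu> (\<lambda>j. e (1 + j) \<omega>)}"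
    by (auto simp: all_tame_def)
  also have "\<dots> \<in> sets M"
    using assms(2) by (intro sets.Un sets_not_tame assms(1)) auto
  finally show ?thesis .
qed

lemma (in prob_space) prob_not_all_tame_le:
  fixes e :: "nat \<Rightarrow> 'a \<Rightarrow> real"
  assumes ind: "indep_vars (\<lambda>_. borel) e {1..n}"
    and int2: "\<And>i. i \<in> {1..n} \<Longrightarrow> integrable M (\<lambda>\<omega>. (e i \<omega>)\<^sup>2)"
    and mean: "\<And>i. i \<in> {1..n} \<Longrightarrow> expectation (e i) = 0"
    and var: "\<And>i. i \<in> {1..n} \<Longrightarrow> expectation (\<lambda>\<omega>. (e i \<omega>)\<^sup>2) \<le> v"
    and pos: "1 \<le> k" "k < n" "1 \<le> d" "0 < l" "0 < \<mu>"
  shows "prob {\<omega>\<in>space M. \<not> all_tame n k d l \<mu> (\<lambda>i. e i \<omega>)}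
    \<le> 2 * v * ((1 + ln (real k)) / (l\<^sup>2 * real k) + (1 + ln (real (n - k))) / (l\<^sup>2 * real (n - k))
        + 4 / (l\<^sup>2 * real d) + 2 * real d / \<mu>\<^sup>2)"
proof -
  have meas: "random_variable borel (e i)" if "i \<in> {1..n}" for i
    using ind that by (auto simp: indep_vars_def)
  define T where "T m h = {\<omega>\<in>space M. \<not> tame m d l \<mu> (\<lambda>j. e (h j) \<omega>)}" for m and h :: "nat \<Rightarrow> nat"
  have T: "T m h \<in> events"
    "prob (T m h) \<le> v * ((1 + ln (real m)) / (l\<^sup>2 * real m) + 2 / (l\<^sup>2 * real d) + real d / \<mu>\<^sup>2)"
    if h: "inj_on h {..<m}" "h ` {..<m} \<subseteq> {1..n}" "1 \<le> m" for h m
  proof -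
    have h': "h i \<in> {1..n}" if "i < m" for i using h(2) that by auto
    show "T m h \<in> events"
      unfolding T_def by (intro sets_not_tame meas h')
    show "prob (T m h) \<le> v * ((1 + ln (real m)) / (l\<^sup>2 * real m) + 2 / (l\<^sup>2 * real d) + real d / \<mu>\<^sup>2)"
      unfolding T_def
      by (intro prob_not_tame_le indep_vars_reindex[OF ind h(1,2)] int2 mean var h' h(3) pos)
  qed
  let ?h1 = "\<lambda>j. k + 1 + j" and ?h2 = "\<lambda>j. n - j" and ?h3 = "\<lambda>j. k - j" and ?h4 = "\<lambda>j. 1 + j"
  have i1: "inj_on ?h1 {..<n-k}" "?h1 ` {..<n-k} \<subseteq> {1..n}" "1 \<le> n - k"
    using pos by (auto simp: inj_on_def)
  have i2: "inj_on ?h2 {..<n-k}" "?h2 ` {..<n-k} \<subseteq> {1..n}" "1 \<le> n - k"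
    using pos by (auto simp: inj_on_def)
  have i3: "inj_on ?h3 {..<k}" "?h3 ` {..<k} \<subseteq> {1..n}" "1 \<le> k"
    using pos by (auto simp: inj_on_def)
  have i4: "inj_on ?h4 {..<k}" "?h4 ` {..<k} \<subseteq> {1..n}" "1 \<le> k"
    using pos by (auto simp: inj_on_def)
  have "{\<omega>\<in>space M. \<not> all_tame n k d l \<mu> (\<lambda>i. e i \<omega>)}
      = T (n - k) ?h1 \<union> T (n - k) ?h2 \<union> (T k ?h3 \<union> T k ?h4)"
    by (auto simp: all_tame_def T_def)
  then have "prob {\<omega>\<in>space M. \<not> all_tame n k d l \<mu> (\<lambda>i. e i \<omega>)}
      \<le> (prob (T (n - k) ?h1) + prob (T (n - k) ?h2)) + (prob (T k ?h3) + prob (T k ?h4))"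
    using T(1)[OF i1] T(1)[OF i2] T(1)[OF i3] T(1)[OF i4]
    by (auto intro!: order_trans[OF measure_Un_le] add_mono)
  also note T(2)[OF i1]
  also note T(2)[OF i2]
  also note T(2)[OF i3]
  also note T(2)[OF i4]
  finally show ?thesis by (simp add: algebra_simps)
qed

text \<open>Every \<open>d\<close> of order strictly between \<open>1 / \<delta>\<^sup>2\<close> and \<open>sqrt n / \<delta>\<close> would do; the proof takes their
  geometric mean \<open>sqrt n / (\<delta> * sqrt (sqrt n * \<delta>))\<close>.\<close>

lemma localization_window:
  fixes \<delta> :: "nat \<Rightarrow> real"
  assumes r: "filterlim (\<lambda>n. sqrt (real n) * \<delta> n) at_top sequentially" and \<delta>: "\<delta> \<longlonglongrightarrow> 0"
  obtains d :: "nat \<Rightarrow> nat" where "\<forall>n. 1 \<le> d n"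
    "(\<lambda>n. 1 / ((\<delta> n)\<^sup>2 * real (d n))) \<longlonglongrightarrow> 0" "(\<lambda>n. \<delta> n * real (d n) / sqrt (real n)) \<longlonglongrightarrow> 0"
    "(\<lambda>n. real (d n) / real n) \<longlonglongrightarrow> 0"
proof -
  \<comment> \<open>With this \<open>q\<close>, both \<open>1 / (\<delta>\<^sup>2 * x)\<close> and
    \<open>\<delta> * x / sqrt n\<close> equal \<open>1 / q\<close>, which tends to 0. Rounding
    costs at most 2, and the added 1 in \<open>d\<close> keeps it positive for every
    \<open>n\<close>.\<close>
  define q where "q n = sqrt (sqrt (real n) * \<delta> n)" for n
  define x where "x n = sqrt (real n) / (\<delta> n * q n)" for n
  define d where "d n = nat \<lceil>x n\<rceil> + 1" for n
  have q: "filterlim q at_top sequentially"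
    unfolding q_def by (rule filterlim_compose[OF sqrt_at_top r])
  have iq: "(\<lambda>n. 1 / q n) \<longlonglongrightarrow> 0"
    by (rule tendsto_divide_0[OF tendsto_const filterlim_at_top_imp_at_infinity[OF q]])
  have in0: "(\<lambda>n. 1 / real n) \<longlonglongrightarrow> 0"
    by (rule lim_1_over_n)
  have pos: "\<forall>\<^sub>F n in sequentially. 0 < \<delta> n \<and> 1 < q n \<and> 1 \<le> n \<and> x n \<le> real (d n) \<and> real (d n) \<le> x n + 2"
    using filterlim_at_top_dense[THEN iffD1, OF q, rule_format, of 1] eventually_ge_at_top[of 1]
  proof eventually_elim
    case (elim n)
    then have "1 < sqrt (real n) * \<delta> n" unfolding q_def by simp
    then have "0 < sqrt (real n) * \<delta> n" by simp
    then have "0 < \<delta> n" by (simp add: zero_less_mult_iff)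
    then have "0 \<le> x n" using elim by (simp add: x_def)
    then show ?case using elim \<open>0 < \<delta> n\<close> unfolding d_def by linarith
  qed
  have qq: "(q n)\<^sup>2 = sqrt (real n) * \<delta> n" if "0 < \<delta> n" for n
    using that by (simp add: q_def)
  have e1: "\<forall>\<^sub>F n in sequentially. 0 \<le> 1 / ((\<delta> n)\<^sup>2 * real (d n))"
    by simp
  have e2: "\<forall>\<^sub>F n in sequentially. 1 / ((\<delta> n)\<^sup>2 * real (d n)) \<le> 1 / q n"
    using pos
  proof eventually_elim
    case (elim n)
    then have "q n * q n = sqrt (real n) * \<delta> n" using qq[of n] by (simp add: power2_eq_square)
    then have "q n = (\<delta> n)\<^sup>2 * x n"
      using elim by (simp add: x_def field_simps power2_eq_square)
    also have "\<dots> \<le> (\<delta> n)\<^sup>2 * real (d n)" using elim by (intro mult_left_mono) auto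
    finally show ?case using elim by (intro divide_left_mono mult_pos_pos) (auto simp: d_def)
  qed
  have up: "\<forall>\<^sub>F n in sequentially. \<delta> n * real (d n) / sqrt (real n) \<le> 1 / q n + 2 * (\<delta> n * sqrt (1 / real n))"
    using pos
  proof eventually_elim
    case (elim n)
    have "\<delta> n * real (d n) / sqrt (real n) \<le> \<delta> n * (x n + 2) / sqrt (real n)"
      using elim by (intro divide_right_mono mult_left_mono) auto
    also have "\<dots> = 1 / q n + 2 * (\<delta> n * sqrt (1 / real n))"
      using elim by (simp add: x_def field_simps real_sqrt_divide)
    finally show ?case .
  qed
  have f0: "(\<lambda>n. 1 / q n + 2 * (\<delta> n * sqrt (1 / real n))) \<longlonglongrightarrow> 0"
    using tendsto_add[OF iq tendsto_mult[OF tendsto_const[of 2] tendsto_mult[OF \<delta> tendsto_real_sqrt[OF in0]]]] by simp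
  have l2: "(\<lambda>n. \<delta> n * real (d n) / sqrt (real n)) \<longlonglongrightarrow> 0"
    using pos by (intro tendsto_sandwich[OF _ up tendsto_const f0]) (auto elim: eventually_mono)
  have "\<forall>\<^sub>F n in sequentially. real (d n) / real n \<le> \<delta> n * real (d n) / sqrt (real n)"
    using pos
  proof eventually_elim
    case (elim n)
    have "1 \<le> sqrt (real n) * \<delta> n"
      using elim one_less_power[of "q n" 2] by (simp add: qq)
    then have "1 / sqrt (real n) \<le> \<delta> n" using elim by (simp add: field_simps)
    then have "1 / sqrt (real n) * (real (d n) / sqrt (real n)) \<le> \<delta> n * (real (d n) / sqrt (real n))"
      by (rule mult_right_mono) simp
    then show ?case by simp
  qed
  \<comment> \<open>Eventually \<open>sqrt n * \<delta> \<ge> 1\<close>, so \<open>d / n\<close> is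
    dominated by \<open>\<delta> * d / sqrt n\<close>.\<close>
  then have l3: "(\<lambda>n. real (d n) / real n) \<longlonglongrightarrow> 0"
    by (intro tendsto_sandwich[OF _ _ tendsto_const l2]) auto
  show thesis
    by (rule that[OF _ tendsto_sandwich[OF e1 e2 tendsto_const iq] l2 l3]) (simp add: d_def)
qed

lemma residual_sum_of_squares_eq_blocks:
  "k \<le> n \<Longrightarrow> residual_sum_of_squares n z k
    = block_rss (\<lambda>i. (z i)\<^sup>2) {1..k} + block_rss (\<lambda>i. (z i)\<^sup>2) {k+1..n}"
  by (simp add: residual_sum_of_squares_def block_rss_def block_mean_def mean_sq_before_def
      mean_sq_after_def of_nat_diff)

lemma standard_brownian_motion_increments:
  assumes BM: "standard_brownian_motion M W" and "0 < \<delta>"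
  shows "prob_space.indep_vars M (\<lambda>_. borel)
      (\<lambda>i \<omega>. (W (real i * \<delta>) \<omega> - W (real (i - 1) * \<delta>) \<omega>) / sqrt \<delta>) {1..n}"
    and "1 \<le> i \<Longrightarrow> distr M borel (\<lambda>\<omega>. (W (real i * \<delta>) \<omega> - W (real (i - 1) * \<delta>) \<omega>) / sqrt \<delta>)
      = std_normal_distribution"
proof -
  interpret prob_space M using BM by (simp add: standard_brownian_motion_def)
  have ind: "indep_vars (\<lambda>_. borel) (\<lambda>i \<omega>. W (t (Suc i)) \<omega> - W (t i) \<omega>) {..<n}"
    if "0 \<le> t 0" "\<forall>i<n. t i \<le> t (Suc i)" for t
    using BM that unfolding standard_brownian_motion_def by blast
  have "indep_vars (\<lambda>_. borel) (\<lambda>i \<omega>. W (real (Suc i) * \<delta>) \<omega> - W (real i * \<delta>) \<omega>) {..<n}"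
    by (rule ind[of "\<lambda>i. real i * \<delta>"]) (use \<open>0 < \<delta>\<close> in \<open>auto intro!: mult_right_mono\<close>)
  \<comment> \<open>Shifts the increments, numbered from 0 in the independence clause, to the
    numbering \<open>1..n\<close> of the observations.\<close>
  from indep_vars_reindex[OF this, of "\<lambda>i. i - 1" "{1..n}"]
  have "indep_vars (\<lambda>_. borel) (\<lambda>i \<omega>. W (real (Suc (i - 1)) * \<delta>) \<omega> - W (real (i - 1) * \<delta>) \<omega>) {1..n}"
    by (force simp: inj_on_def)
  from indep_vars_compose2[OF this, of "\<lambda>_ x. x / sqrt \<delta>"]
  have "indep_vars (\<lambda>_. borel) (\<lambda>i \<omega>. (W (real (Suc (i - 1)) * \<delta>) \<omega> - W (real (i - 1) * \<delta>) \<omega>) / sqrt \<delta>) {1..n}"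
    by simp
  then show "indep_vars (\<lambda>_. borel) (\<lambda>i \<omega>. (W (real i * \<delta>) \<omega> - W (real (i - 1) * \<delta>) \<omega>) / sqrt \<delta>) {1..n}"
    by (rule indep_vars_cong[THEN iffD1, rotated -1]) auto
  assume i: "1 \<le> i"
  have "real i * \<delta> - real (i - 1) * \<delta> = \<delta>" using i by (simp add: of_nat_diff algebra_simps)
  moreover have "real (i - 1) * \<delta> < real i * \<delta>" using i \<open>0 < \<delta>\<close> by simp
  moreover have "0 \<le> real (i - 1) * \<delta>" using \<open>0 < \<delta>\<close> by simp
  ultimately have "distributed M lborel (\<lambda>\<omega>. W (real i * \<delta>) \<omega> - W (real (i - 1) * \<delta>) \<omega>) (normal_density 0 (sqrt \<delta>))"
    using BM unfolding standard_brownian_motion_def by metis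
  then have "distributed M lborel (\<lambda>\<omega>. (W (real i * \<delta>) \<omega> - W (real (i - 1) * \<delta>) \<omega> - 0) / sqrt \<delta>) std_normal_density"
    using \<open>0 < \<delta>\<close> by (subst normal_standard_normal_convert[symmetric]) auto
  then have "distr M lborel (\<lambda>\<omega>. (W (real i * \<delta>) \<omega> - W (real (i - 1) * \<delta>) \<omega>) / sqrt \<delta>) = std_normal_distribution"
    by (simp add: distributed_def)
  moreover have "distr M borel (\<lambda>\<omega>. (W (real i * \<delta>) \<omega> - W (real (i - 1) * \<delta>) \<omega>) / sqrt \<delta>)
      = distr M lborel (\<lambda>\<omega>. (W (real i * \<delta>) \<omega> - W (real (i - 1) * \<delta>) \<omega>) / sqrt \<delta>)"
    by (rule distr_cong) auto
  ultimately show "distr M borel (\<lambda>\<omega>. (W (real i * \<delta>) \<omega> - W (real (i - 1) * \<delta>) \<omega>) / sqrt \<delta>)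
      = std_normal_distribution"
    by simp
qed

text \<open>The Gaussian core, freed of the diffusion: each row \<open>\<xi> n\<close> consists of
  independent standard normals, and nothing is assumed about the joint law of different
  rows.\<close>

theorem least_squares_change_point_clt:
  fixes M :: "'a measure" and \<xi> z :: "nat \<Rightarrow> nat \<Rightarrow> 'a \<Rightarrow> real"
    and \<theta>1 \<theta>2 :: "nat \<Rightarrow> real" and \<tau> \<theta> :: real and k0 :: "nat \<Rightarrow> nat" and kh :: "nat \<Rightarrow> 'a \<Rightarrow> nat"
  assumes "prob_space M"
    and ind: "\<And>n. 1 \<le> n \<Longrightarrow> prob_space.indep_vars M (\<lambda>_. borel) (\<xi> n) {1..n}"
    and law: "\<And>n i. 1 \<le> i \<Longrightarrow> i \<le> n \<Longrightarrow> distr M borel (\<xi> n i) = std_normal_distribution"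
    and \<tau>: "0 < \<tau>" "\<tau> < 1" and k0: "\<And>n. k0 n = nat \<lfloor>real n * \<tau>\<rfloor>"
    and pos: "\<And>n. 0 < \<theta>1 n" "\<And>n. 0 < \<theta>2 n" "0 < \<theta>"
    and lim: "\<theta>1 \<longlonglongrightarrow> \<theta>" "\<theta>2 \<longlonglongrightarrow> \<theta>"
    and rate: "filterlim (\<lambda>n. sqrt (real n) * (\<theta>2 n - \<theta>1 n) / sqrt (ln (real n))) at_top sequentially"
    and z: "\<And>n i \<omega>. 1 \<le> i \<Longrightarrow> i \<le> n \<Longrightarrow> \<omega> \<in> space M \<Longrightarrow>
      z n i \<omega> = sqrt (if i \<le> k0 n then \<theta>1 n else \<theta>2 n) * \<xi> n i \<omega>"
    and kh: "\<And>n. 2 \<le> n \<Longrightarrow> least_squares_change_point M n (z n) (kh n)"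
  shows "converges_in_distribution M
     (\<lambda>n \<omega>. sqrt (real n) *\<^sub>R
        (vector [mean_sq_before (\<lambda>i. z n i \<omega>) (kh n \<omega>) - \<theta>1 n,
                 mean_sq_after n (\<lambda>i. z n i \<omega>) (kh n \<omega>) - \<theta>2 n] :: real^2))
     (multivariate_normal 0
        (vector [vector [2 * inverse \<tau> * \<theta>\<^sup>2, 0],
                 vector [0, 2 * inverse (1 - \<tau>) * \<theta>\<^sup>2]] :: real^2^2))"
proof -
  interpret prob_space M by fact
  define \<rho> where "\<rho> n i = (if i \<le> k0 n then \<theta>1 n else \<theta>2 n)" for n i
  define e where "e n i \<omega> = \<rho> n i * ((\<xi> n i \<omega>)\<^sup>2 - 1)" for n i \<omega>
  define \<delta> where "\<delta> n = \<theta>2 n - \<theta>1 n" for n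
  define S1 where "S1 n \<omega> = (\<Sum>i=1..k0 n. e n i \<omega>) / real (k0 n)" for n \<omega>
  define S2 where "S2 n \<omega> = (\<Sum>i=k0 n+1..n. e n i \<omega>) / (real n - real (k0 n))" for n \<omega>
  define D1 where "D1 n \<omega> = mean_sq_before (\<lambda>i. z n i \<omega>) (kh n \<omega>) - \<theta>1 n" for n \<omega>
  define D2 where "D2 n \<omega> = mean_sq_after n (\<lambda>i. z n i \<omega>) (kh n \<omega>) - \<theta>2 n" for n \<omega>
  define A where "A n \<omega> = chi_square_sum (k0 n) (\<lambda>j. \<xi> n (1 + j) \<omega>)" for n \<omega>
  define B where "B n \<omega> = chi_square_sum (n - k0 n) (\<lambda>j. \<xi> n (k0 n + 1 + j) \<omega>)" for n \<omega>
  \<comment> \<open>\<open>a n\<close> and \<open>b n\<close> turn the normalized sums into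
    \<open>sqrt n\<close> times the noise means; their limits are the square roots of the diagonal
    entries of the covariance.\<close>
  define a where "a n = \<theta>1 n * sqrt (2 * (real n / real (k0 n)))" for n
  define b where "b n = \<theta>2 n * sqrt (2 * (real n / real (n - k0 n)))" for n
  let ?\<alpha> = "\<theta> * sqrt (2 * (1 / \<tau>))" and ?\<beta> = "\<theta> * sqrt (2 * (1 / (1 - \<tau>)))"
  let ?\<Sigma> = "vector [vector [2 * inverse \<tau> * \<theta>\<^sup>2, 0], vector [0, 2 * inverse (1 - \<tau>) * \<theta>\<^sup>2]] :: real^2^2"
  have \<xi>m [measurable]: "random_variable borel (\<xi> n i)" if "i \<in> {1..n}" for n i
    using ind[of n] that by (auto simp: indep_vars_def)

  \<comment> \<open>Lengths of the two true segments\<close>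
  have k0_frac: "(\<lambda>n. real (k0 n) / real n) \<longlonglongrightarrow> \<tau>"
  proof (rule tendsto_sandwich)
    show "\<forall>\<^sub>F n in sequentially. \<tau> - 1 / real n \<le> real (k0 n) / real n"
      using eventually_ge_at_top[of 1]
    proof eventually_elim
      case (elim n)
      have "real n * \<tau> - 1 \<le> real (k0 n)" unfolding k0 using \<tau> by linarith
      from divide_right_mono[OF this, of "real n"] show ?case
        using elim by (simp add: diff_divide_distrib)
    qed
    show "\<forall>\<^sub>F n in sequentially. real (k0 n) / real n \<le> \<tau>"
      using eventually_ge_at_top[of 1]
    proof eventually_elim
      case (elim n)
      have "0 \<le> real n * \<tau>" using \<tau> by simp
      then have "real (k0 n) \<le> real n * \<tau>" unfolding k0 by linarith
      from divide_right_mono[OF this, of "real n"] show ?case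
        using elim by simp
    qed
    show "(\<lambda>n. \<tau> - 1 / real n) \<longlonglongrightarrow> \<tau>"
      using tendsto_diff[OF tendsto_const lim_1_over_n, of \<tau>] by simp
  qed simp
  have k0_le: "k0 n \<le> n" for n
  proof -
    have "real n * \<tau> \<le> real n" using \<tau> by (simp add: mult_left_le)
    then show ?thesis unfolding k0 by linarith
  qed
  have k1_frac: "(\<lambda>n. real (n - k0 n) / real n) \<longlonglongrightarrow> 1 - \<tau>"
  proof (rule Lim_transform_eventually[OF tendsto_diff[OF tendsto_const[of 1] k0_frac]])
    show "\<forall>\<^sub>F n in sequentially. 1 - real (k0 n) / real n = real (n - k0 n) / real n"
      using eventually_ge_at_top[of 1] by eventually_elim (simp add: of_nat_diff[OF k0_le] diff_divide_distrib)
  qed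
  \<comment> \<open>Strictly below both limiting fractions, so that the segments keep at least
    \<open>c * n\<close> observations even after losing \<open>d n = o(n)\<close> of them.\<close>
  define c where "c = min \<tau> (1 - \<tau>) / 2"
  have c: "0 < c" "c < \<tau>" "c < 1 - \<tau>" "c \<le> 1" using \<tau> by (auto simp: c_def)
  have k0_ev: "\<forall>\<^sub>F n in sequentially. 2 \<le> n \<and> 1 \<le> k0 n \<and> k0 n < n \<and> c * real n \<le> real (k0 n) \<and> c * real n \<le> real (n - k0 n)"
    using order_tendstoD(1)[OF k0_frac c(2)] order_tendstoD(1)[OF k1_frac c(3)] eventually_ge_at_top[of 2]
  proof eventually_elim
    case (elim n)
    then have 1: "c * real n < real (k0 n)" "c * real n < real (n - k0 n)" by (simp_all add: field_simps)
    then have "0 < real (k0 n)" "0 < real (n - k0 n)"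
      using mult_pos_pos[OF c(1), of "real n"] elim by linarith+
    then show ?case using 1 elim by auto
  qed
  have filt: "filterlim h at_top sequentially"
    if "\<forall>\<^sub>F n in sequentially. c * real n \<le> real (h n)" for h :: "nat \<Rightarrow> nat"
  proof -
    have "filterlim (\<lambda>n. c * real n) at_top sequentially"
      using c filterlim_tendsto_pos_mult_at_top[OF tendsto_const c(1) filterlim_real_sequentially] by simp
    then have "filterlim (\<lambda>n. real (h n)) at_top sequentially"
      using that by (rule filterlim_at_top_mono)
    then show ?thesis by (simp add: filterlim_sequentially_iff_filterlim_real)
  qed

  \<comment> \<open>Limit law at the true change point\<close>
  have normal_law: "distr (std_normal_distribution \<Otimes>\<^sub>M std_normal_distribution) borel
      (\<lambda>(x, y). vector [?\<alpha> * x, ?\<beta> * y]) = multivariate_normal 0 ?\<Sigma>"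
  proof -
    have "?\<alpha>\<^sup>2 = 2 * inverse \<tau> * \<theta>\<^sup>2" "?\<beta>\<^sup>2 = 2 * inverse (1 - \<tau>) * \<theta>\<^sup>2"
      using \<tau> by (simp_all add: power_mult_distrib field_simps)
    moreover have "0 < ?\<alpha>" "0 < ?\<beta>" using pos \<tau> by simp_all
    ultimately show ?thesis using multivariate_normal_diag_2[of ?\<alpha> ?\<beta>] by simp
  qed
  have leading: "converges_in_distribution M (\<lambda>n \<omega>. vector [a n * A n \<omega>, b n * B n \<omega>] :: real^2)
    (multivariate_normal 0 ?\<Sigma>)"
  proof -
    have "converges_in_distribution M (\<lambda>n \<omega>. vector [a n * A n \<omega>, b n * B n \<omega>] :: real^2)
      (distr (std_normal_distribution \<Otimes>\<^sub>M std_normal_distribution) borel (\<lambda>(x, y). vector [?\<alpha> * x, ?\<beta> * y]))"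
    proof (rule converges_in_distribution_indep_pair[OF \<open>prob_space M\<close> real_distribution_chi_square_sum_law
          real_dist_normal_dist weak_conv_chi_square_sum_law])
      show "filterlim k0 at_top sequentially" "filterlim (\<lambda>n. n - k0 n) at_top sequentially"
        using k0_ev by (auto intro!: filt elim: eventually_mono)
      have "(\<lambda>n. real n / real (k0 n)) \<longlonglongrightarrow> 1 / \<tau>" "(\<lambda>n. real n / real (n - k0 n)) \<longlonglongrightarrow> 1 / (1 - \<tau>)"
        using tendsto_divide[OF tendsto_const[of 1] k0_frac] tendsto_divide[OF tendsto_const[of 1] k1_frac] \<tau> by auto
      then show "a \<longlonglongrightarrow> ?\<alpha>" "b \<longlonglongrightarrow> ?\<beta>"
        unfolding a_def b_def by - (intro tendsto_mult tendsto_real_sqrt tendsto_const lim, assumption)+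
      show "\<forall>\<^sub>F n in sequentially. indep_var borel (A n) borel (B n)"
        using k0_ev
      proof eventually_elim
        case (elim n)
        have "indep_var (PiM {1..k0 n} (\<lambda>_. borel)) (\<lambda>\<omega>. restrict (\<lambda>i. \<xi> n i \<omega>) {1..k0 n})
          (PiM {k0 n+1..n} (\<lambda>_. borel)) (\<lambda>\<omega>. restrict (\<lambda>i. \<xi> n i \<omega>) {k0 n+1..n})"
          using elim by (intro indep_var_restrict[OF ind]) auto
        from indep_var_compose[OF this, of "\<lambda>x. chi_square_sum (k0 n) (\<lambda>j. x (1 + j))" borel
            "\<lambda>x. chi_square_sum (n - k0 n) (\<lambda>j. x (k0 n + 1 + j))" borel]
        have "indep_var borel ((\<lambda>x. chi_square_sum (k0 n) (\<lambda>j. x (1 + j))) \<circ> (\<lambda>\<omega>. restrict (\<lambda>i. \<xi> n i \<omega>) {1..k0 n}))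
          borel ((\<lambda>x. chi_square_sum (n - k0 n) (\<lambda>j. x (k0 n + 1 + j))) \<circ> (\<lambda>\<omega>. restrict (\<lambda>i. \<xi> n i \<omega>) {k0 n+1..n}))"
          unfolding chi_square_sum_def
          by (auto intro!: borel_measurable_divide borel_measurable_sum borel_measurable_diff
              borel_measurable_power measurable_component_singleton)
        moreover have "(\<lambda>x. chi_square_sum (k0 n) (\<lambda>j. x (1 + j))) \<circ> (\<lambda>\<omega>. restrict (\<lambda>i. \<xi> n i \<omega>) {1..k0 n}) = A n"
          by (auto simp: A_def chi_square_sum_def fun_eq_iff)
        moreover have "(\<lambda>x. chi_square_sum (n - k0 n) (\<lambda>j. x (k0 n + 1 + j))) \<circ> (\<lambda>\<omega>. restrict (\<lambda>i. \<xi> n i \<omega>) {k0 n+1..n}) = B n"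
          by (auto simp: B_def chi_square_sum_def fun_eq_iff intro!: arg_cong2[where f="(/)"] sum.cong)
        ultimately show ?case by simp
      qed
      show "\<forall>\<^sub>F n in sequentially. distr M borel (A n) = chi_square_sum_law (k0 n)"
        using k0_ev
      proof eventually_elim
        case (elim n)
        show ?case unfolding A_def
          using elim by (intro distr_chi_square_sum indep_vars_reindex[OF ind] law) (auto simp: inj_on_def)
      qed
      show "\<forall>\<^sub>F n in sequentially. distr M borel (B n) = chi_square_sum_law (n - k0 n)"
        using k0_ev
      proof eventually_elim
        case (elim n)
        show ?case unfolding B_def
          using elim by (intro distr_chi_square_sum indep_vars_reindex[OF ind] law) (auto simp: inj_on_def)
      qed
    qed
    then show ?thesis unfolding normal_law .
  qed

  \<comment> \<open>For \<open>k = 0\<close> both sides are 0, as division by zero gives zero; hence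
    \<open>U_eq\<close> holds for every \<open>n\<close>.\<close>
  have scale: "sqrt (real n) * (t * s / real k) = t * sqrt (2 * (real n / real k)) * (s / sqrt (real k * 2))"
    for n k and t s :: real
  proof -
    have "sqrt (2 * (real n / real k)) / sqrt (real k * 2) = sqrt (real n) / real k"
      by (simp add: real_sqrt_mult real_sqrt_divide)
    then have "t * s * (sqrt (real n) / real k) = t * s * (sqrt (2 * (real n / real k)) / sqrt (real k * 2))"
      by simp
    then show ?thesis by (simp only: times_divide_eq_right times_divide_eq_left mult.commute mult.left_commute)
  qed
  have U_eq: "sqrt (real n) * S1 n \<omega> = a n * A n \<omega>" "sqrt (real n) * S2 n \<omega> = b n * B n \<omega>" for n \<omega>
  proof -
    have "(\<Sum>i=1..k0 n. e n i \<omega>) = \<theta>1 n * (\<Sum>j<k0 n. (\<xi> n (1 + j) \<omega>)\<^sup>2 - 1)"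
      using sum_forward[of "\<lambda>i. e n i \<omega>" 0 "k0 n"] by (simp add: e_def \<rho>_def sum_distrib_left)
    then show "sqrt (real n) * S1 n \<omega> = a n * A n \<omega>"
      unfolding S1_def A_def a_def chi_square_sum_def by (simp only: scale)
    have "(\<Sum>i=k0 n+1..n. e n i \<omega>) = \<theta>2 n * (\<Sum>j<n - k0 n. (\<xi> n (k0 n + 1 + j) \<omega>)\<^sup>2 - 1)"
      using sum_forward[of "\<lambda>i. e n i \<omega>" "k0 n" "n - k0 n"] k0_le[of n]
      by (simp add: e_def \<rho>_def sum_distrib_left)
    then show "sqrt (real n) * S2 n \<omega> = b n * B n \<omega>"
      unfolding S2_def B_def b_def chi_square_sum_def of_nat_diff[OF k0_le, symmetric] by (simp only: scale)
  qed

  \<comment> \<open>Total mass 1 is read off from the image representation, with no integration of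
    the density.\<close>
  have L: "prob_space (multivariate_normal 0 ?\<Sigma>)" "sets (multivariate_normal 0 ?\<Sigma>) = sets borel"
  proof -
    interpret N: prob_space std_normal_distribution by (rule prob_space_std_normal)
    interpret N2: pair_prob_space std_normal_distribution std_normal_distribution ..
    show "prob_space (multivariate_normal 0 ?\<Sigma>)"
      unfolding normal_law[symmetric] by (rule N2.prob_space_distr) (auto simp: split_beta')
  qed (simp add: multivariate_normal_def)

  \<comment> \<open>Measurability of the normalized errors\<close>
  have kh_range: "1 \<le> kh n \<omega>" "kh n \<omega> < n" if "2 \<le> n" "\<omega> \<in> space M" for n \<omega>
    using kh[OF that(1)] that by (auto simp: least_squares_change_point_def is_arg_min_def)

  have meas: "\<forall>\<^sub>F n in sequentially. (\<lambda>\<omega>. sqrt (real n) *\<^sub>R (vector [D1 n \<omega>, D2 n \<omega>] :: real^2)) \<in> borel_measurable M"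
    using eventually_ge_at_top[of 2]
  proof eventually_elim
    case (elim n)
    \<comment> \<open>\<open>z\<close> is specified only for indices \<open>1..n\<close> and on the
      sample space. Composition with the random index \<open>kh n\<close> asks for measurability at
      every \<open>k\<close>, so a total, measurable version is used and compared with
      \<open>z\<close> on the range of \<open>kh n\<close>.\<close>
    define \<zeta> where "\<zeta> i \<omega> = (if i \<in> {1..n} then sqrt (\<rho> n i) * \<xi> n i \<omega> else 0)" for i \<omega>
    have [measurable]: "random_variable borel (\<zeta> i)" for i
      unfolding \<zeta>_def[abs_def] by (cases "i \<in> {1..n}") auto
    have [measurable]: "kh n \<in> measurable M (count_space UNIV)"
      using kh[OF elim] by (simp add: least_squares_change_point_def)
    have "(\<lambda>\<omega>. mean_sq_before (\<lambda>i. \<zeta> i \<omega>) (kh n \<omega>) - \<theta>1 n) \<in> borel_measurable M"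
      by (rule measurable_compose_countable[where f="\<lambda>k \<omega>. mean_sq_before (\<lambda>i. \<zeta> i \<omega>) k - \<theta>1 n"])
        (unfold mean_sq_before_def, measurable)
    then have [measurable]: "random_variable borel (D1 n)"
      by (rule measurable_cong[THEN iffD1, rotated])
        (use kh_range[OF elim] in \<open>force simp: D1_def mean_sq_before_def \<zeta>_def \<rho>_def z intro!: sum.cong\<close>)
    have "(\<lambda>\<omega>. mean_sq_after n (\<lambda>i. \<zeta> i \<omega>) (kh n \<omega>) - \<theta>2 n) \<in> borel_measurable M"
      by (rule measurable_compose_countable[where f="\<lambda>k \<omega>. mean_sq_after n (\<lambda>i. \<zeta> i \<omega>) k - \<theta>2 n"])
        (unfold mean_sq_after_def, measurable)
    then have [measurable]: "random_variable borel (D2 n)"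
      by (rule measurable_cong[THEN iffD1, rotated])
        (use kh_range[OF elim] in \<open>force simp: D2_def mean_sq_after_def \<zeta>_def \<rho>_def z intro!: sum.cong\<close>)
    show ?case by measurable
  qed

  \<comment> \<open>Size of the jump and choice of the window\<close>
  have "\<delta> \<longlonglongrightarrow> 0"
    unfolding \<delta>_def using tendsto_diff[OF lim(2,1)] by simp
  define R where "R n = sqrt (real n) * \<delta> n / sqrt (ln (real n))" for n
  have R: "filterlim R at_top sequentially"
    using rate by (simp add: R_def[abs_def] \<delta>_def)
  have ln1: "\<forall>\<^sub>F n::nat in sequentially. 1 \<le> ln (real n)"
  proof -
    have "filterlim (\<lambda>n. ln (real n)) at_top sequentially"
      by (rule filterlim_compose[OF ln_at_top filterlim_real_sequentially])
    then show ?thesis by (simp add: filterlim_at_top)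
  qed
  \<comment> \<open>Divergence of \<open>R\<close> to plus infinity forces
    \<open>\<theta>2 n > \<theta>1 n\<close> eventually. Once \<open>ln n \<ge> 1\<close>,
    \<open>1 + ln n\<close> is at most \<open>2 * ln n\<close>, and dropping the logarithm only
    enlarges the quotient.\<close>
  have R_ev: "\<forall>\<^sub>F n in sequentially. 0 < \<delta> n \<and> R n \<le> sqrt (real n) * \<delta> n
      \<and> (1 + ln (real n)) / ((\<delta> n)\<^sup>2 * real n) \<le> 2 * (1 / R n)\<^sup>2"
    using filterlim_at_top_dense[THEN iffD1, OF R, rule_format, of 0] ln1 eventually_ge_at_top[of 1]
  proof eventually_elim
    case (elim n)
    have "0 < \<delta> n" using elim by (simp add: R_def zero_less_divide_iff zero_less_mult_iff)
    have lnpos: "0 < sqrt (ln (real n))" by (rule real_sqrt_gt_zero) (use elim in linarith)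
    have "sqrt (real n) * \<delta> n * 1 \<le> sqrt (real n) * \<delta> n * sqrt (ln (real n))"
      using elim \<open>0 < \<delta> n\<close> by (intro mult_left_mono) auto
    then have 1: "R n \<le> sqrt (real n) * \<delta> n"
      using elim by (simp only: R_def pos_divide_le_eq[OF lnpos] mult_1_right)
    have "(1 + ln (real n)) / ((\<delta> n)\<^sup>2 * real n) \<le> (2 * ln (real n)) / ((\<delta> n)\<^sup>2 * real n)"
      using elim by (intro divide_right_mono) auto
    also have "\<dots> = 2 * (1 / R n)\<^sup>2"
      using elim by (simp add: R_def power_divide power_mult_distrib)
    finally show ?case using 1 \<open>0 < \<delta> n\<close> by simp
  qed
  have ln_lim: "(\<lambda>n. (1 + ln (real n)) / ((\<delta> n)\<^sup>2 * real n)) \<longlonglongrightarrow> 0"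
  proof (rule tendsto_sandwich[OF _ _ tendsto_const])
    have "(\<lambda>n. 1 / R n) \<longlonglongrightarrow> 0"
      by (rule tendsto_divide_0[OF tendsto_const filterlim_at_top_imp_at_infinity[OF R]])
    then show "(\<lambda>n. 2 * (1 / R n)\<^sup>2) \<longlonglongrightarrow> 0"
      by (auto intro!: tendsto_eq_intros)
    show "\<forall>\<^sub>F n in sequentially. (1 + ln (real n)) / ((\<delta> n)\<^sup>2 * real n) \<le> 2 * (1 / R n)\<^sup>2"
      using R_ev by (auto elim: eventually_mono)
    show "\<forall>\<^sub>F n in sequentially. 0 \<le> (1 + ln (real n)) / ((\<delta> n)\<^sup>2 * real n)"
      using ln1 by eventually_elim simp
  qed
  have signal: "filterlim (\<lambda>n. sqrt (real n) * \<delta> n) at_top sequentially"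
    using R R_ev by (auto intro: filterlim_at_top_mono elim: eventually_mono)
  obtain d where d1: "\<forall>n. 1 \<le> d n"
    and d2: "(\<lambda>n. 1 / ((\<delta> n)\<^sup>2 * real (d n))) \<longlonglongrightarrow> 0"
    and d3: "(\<lambda>n. \<delta> n * real (d n) / sqrt (real n)) \<longlonglongrightarrow> 0"
    and d4: "(\<lambda>n. real (d n) / real n) \<longlonglongrightarrow> 0"
    using localization_window[OF signal \<open>\<delta> \<longlonglongrightarrow> 0\<close>] .

  \<comment> \<open>Comparison of the estimated with the true change point\<close>
  have small: "(\<lambda>n. prob {\<omega>\<in>space M. \<epsilon> \<le> norm (sqrt (real n) *\<^sub>R (vector [D1 n \<omega>, D2 n \<omega>] :: real^2)
      - vector [a n * A n \<omega>, b n * B n \<omega>])}) \<longlonglongrightarrow> 0" if "0 < \<epsilon>" for \<epsilon>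
  proof -
    define \<kappa> where "\<kappa> = sqrt c"
    have \<kappa>: "0 < \<kappa>" "\<kappa> \<le> 1" "\<kappa>\<^sup>2 = c" using c by (simp_all add: \<kappa>_def)
    \<comment> \<open>With \<open>\<delta> n * d n / sqrt n < \<eta> / 2\<close>, the scaled error
      of each mean is at most \<open>(\<eta> + \<eta>) / c = \<epsilon> / 4\<close>, which leaves
      the sum of both strictly below \<open>\<epsilon>\<close>.\<close>
    define \<eta> where "\<eta> = c * \<epsilon> / 8"
    have \<eta>: "0 < \<eta>" using c that by (simp add: \<eta>_def)
    define l where "l n = \<kappa> / 5 * \<delta> n" for n
    define \<mu> where "\<mu> n = \<eta> * sqrt (real n)" for n
    \<comment> \<open>The noise variance is \<open>2 * \<rho>\<^sup>2\<close>, and eventually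
      \<open>\<rho> \<le> 2 * \<theta>\<close>.\<close>
    define v where "v = 2 * (2 * \<theta>)\<^sup>2"
    define bad where "bad n = {\<omega>\<in>space M. \<not> all_tame n (k0 n) (d n) (l n) (\<mu> n) (\<lambda>i. e n i \<omega>)}" for n
    have em: "random_variable borel (e n i)" if "i \<in> {1..n}" for n i
      unfolding e_def[abs_def] using \<xi>m[OF that] by measurable
    have bad_sets: "bad n \<in> events" for n
      unfolding bad_def by (intro sets_not_all_tame em k0_le)
    have room: "\<forall>\<^sub>F n in sequentially. c * real n \<le> real (k0 n) - real (d n) \<and> c * real n \<le> real (n - k0 n) - real (d n)"
    proof -
      have "c < \<tau> - 0" "c < 1 - \<tau> - 0" using c by simp_all
      note order_tendstoD(1)[OF tendsto_diff[OF k0_frac d4] this(1)]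
        order_tendstoD(1)[OF tendsto_diff[OF k1_frac d4] this(2)]
      then show ?thesis
        using eventually_ge_at_top[of 1]
    proof eventually_elim
      case (elim n)
      then show ?case
        by (simp add: diff_divide_distrib[symmetric] pos_less_divide_eq)
    qed
    qed
    have half_pos: "0 < \<eta> / 2" using \<eta> by simp
    \<comment> \<open>On a path outside \<open>bad n\<close> the deterministic
      \<open>change_point_tame\<close> applies, so the two vectors differ by less than
      \<open>\<epsilon>\<close>. Only \<open>bad n\<close> has to be an event for the resulting
      comparison of probabilities.\<close>
    have sub: "\<forall>\<^sub>F n in sequentially. {\<omega>\<in>space M. \<epsilon> \<le> norm (sqrt (real n) *\<^sub>R (vector [D1 n \<omega>, D2 n \<omega>] :: real^2)
      - vector [a n * A n \<omega>, b n * B n \<omega>])} \<subseteq> bad n"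
      using k0_ev room R_ev order_tendstoD(2)[OF d3 half_pos]
    proof eventually_elim
      case (elim n)
      show ?case
      proof (rule subsetI, rule ccontr)
        fix \<omega> assume "\<omega> \<in> {\<omega>\<in>space M. \<epsilon> \<le> norm (sqrt (real n) *\<^sub>R (vector [D1 n \<omega>, D2 n \<omega>] :: real^2)
          - vector [a n * A n \<omega>, b n * B n \<omega>])}" and "\<omega> \<notin> bad n"
        then have w: "\<omega> \<in> space M"
          and big: "\<epsilon> \<le> norm (sqrt (real n) *\<^sub>R (vector [D1 n \<omega>, D2 n \<omega>] :: real^2)
            - vector [a n * A n \<omega>, b n * B n \<omega>])"
          and tame: "all_tame n (k0 n) (d n) (l n) (\<mu> n) (\<lambda>i. e n i \<omega>)"
          by (auto simp: bad_def)
        let ?y = "\<lambda>i. (z n i \<omega>)\<^sup>2" and ?k = "kh n \<omega>"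
        have n: "2 \<le> n" "0 < real n" "0 < \<delta> n" using elim by auto
        have y: "\<forall>i\<in>{1..n}. ?y i = (if i \<le> k0 n then \<theta>1 n else \<theta>2 n) + e n i \<omega>"
          using pos(1,2)[of n] less_imp_le w
          by (auto simp: z e_def \<rho>_def power_mult_distrib algebra_simps)
        have arg: "is_arg_min (\<lambda>k. block_rss ?y {1..k} + block_rss ?y {k+1..n}) (\<lambda>k. 1 \<le> k \<and> k \<le> n - 1) ?k"
          using kh[OF n(1)] w by (auto simp: least_squares_change_point_def is_arg_min_def residual_sum_of_squares_eq_blocks)
        have ab: "\<bar>\<theta>2 n - \<theta>1 n\<bar> = \<delta> n" "\<bar>\<theta>1 n - \<theta>2 n\<bar> = \<delta> n" "\<theta>1 n \<noteq> \<theta>2 n"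
          using n by (auto simp: \<delta>_def)
        have mu: "0 < \<mu> n" using n \<eta> by (simp add: \<mu>_def)
        have kap: "\<kappa>\<^sup>2 * real n \<le> real (k0 n)" "\<kappa>\<^sup>2 * real n \<le> real n - real (k0 n)"
          using elim \<kappa> by (auto simp: of_nat_diff)
        have prems: "1 \<le> k0 n" "k0 n < n" "l n = \<kappa> / 5 * \<bar>\<theta>1 n - \<theta>2 n\<bar>"
          using elim ab by (auto simp: l_def)
        have tame': "tame (n - k0 n) (d n) (l n) (\<mu> n) (\<lambda>j. e n (k0 n + 1 + j) \<omega>)"
          "tame (n - k0 n) (d n) (l n) (\<mu> n) (\<lambda>j. e n (n - j) \<omega>)"
          "tame (k0 n) (d n) (l n) (\<mu> n) (\<lambda>j. e n (k0 n - j) \<omega>)"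
          "tame (k0 n) (d n) (l n) (\<mu> n) (\<lambda>j. e n (1 + j) \<omega>)"
          using tame by (auto simp: all_tame_def)
        note cp' = change_point_tame[where e="\<lambda>i. e n i \<omega>" and y="?y" and a="\<theta>1 n" and b="\<theta>2 n"
            and \<kappa>=\<kappa> and l="l n" and \<mu>="\<mu> n" and d="d n" and n=n and ?k0.0="k0 n" and k="?k",
            OF prems(1,2) y \<kappa>(1,2) kap prems(3) ab(3) mu d1[rule_format] tame' arg, unfolded ab, folded S1_def S2_def]
        \<comment> \<open>The estimate is within \<open>d n\<close> of \<open>k0 n\<close>, so
          \<open>room\<close> leaves at least \<open>c * n\<close> observations on either side of
          it.\<close>
        have k: "c * real n \<le> real ?k" "c * real n \<le> real n - real ?k"
          using cp'(1,2) elim by (auto simp: of_nat_diff)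
        have cn: "0 < c * real n" using c n by simp
        have M0: "0 \<le> \<mu> n + 2 * \<delta> n * real (d n)" using mu n by simp
        have fin: "sqrt (real n) * x \<le> \<epsilon> / 4"
          if "x \<le> (\<mu> n + 2 * \<delta> n * real (d n)) / q" "c * real n \<le> q" for x q
        proof -
          have "x \<le> (\<mu> n + 2 * \<delta> n * real (d n)) / (c * real n)"
            using that cn M0 by (intro order_trans[OF that(1)] divide_left_mono) (auto intro: mult_pos_pos less_le_trans)
          then have "sqrt (real n) * x \<le> sqrt (real n) * ((\<mu> n + 2 * \<delta> n * real (d n)) / (c * real n))"
            by (intro mult_left_mono) auto
          also have "\<dots> = (sqrt (real n) * sqrt (real n) / real n) * (\<eta> + 2 * (\<delta> n * real (d n) / sqrt (real n))) / c"
            using n c by (simp add: \<mu>_def field_simps)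
          also have "\<dots> = (\<eta> + 2 * (\<delta> n * real (d n) / sqrt (real n))) / c"
            using n by simp
          also have "\<dots> \<le> (\<eta> + 2 * (\<eta> / 2)) / c"
            using elim \<eta> c by (intro divide_right_mono add_left_mono mult_left_mono) auto
          also have "\<dots> = \<epsilon> / 4" using c by (simp add: \<eta>_def)
          finally show ?thesis .
        qed
        have "\<bar>D1 n \<omega> - S1 n \<omega>\<bar> \<le> (\<mu> n + 2 * \<delta> n * real (d n)) / real ?k"
          using cp'(3) by (simp add: D1_def mean_sq_before_def block_mean_def)
        note f1 = fin[OF this k(1)]
        have "\<bar>D2 n \<omega> - S2 n \<omega>\<bar> \<le> (\<mu> n + 2 * \<delta> n * real (d n)) / (real n - real ?k)"
          using cp'(4) kh_range[OF n(1) w] by (simp add: D2_def mean_sq_after_def block_mean_def of_nat_diff)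
        note f2 = fin[OF this k(2)]
        have "norm (sqrt (real n) *\<^sub>R (vector [D1 n \<omega>, D2 n \<omega>] :: real^2) - vector [a n * A n \<omega>, b n * B n \<omega>])
            \<le> \<bar>sqrt (real n) * (D1 n \<omega> - S1 n \<omega>)\<bar> + \<bar>sqrt (real n) * (D2 n \<omega> - S2 n \<omega>)\<bar>"
          by (rule order_trans[OF norm_le_l1_cart]) (simp add: sum_2 right_diff_distrib U_eq)
        also have "\<dots> \<le> \<epsilon> / 4 + \<epsilon> / 4"
          using f1 f2 by (intro add_mono) (simp_all add: abs_mult)
        finally show False using big \<open>0 < \<epsilon>\<close> by simp
      qed
    qed
    have less_double: "\<theta> < 2 * \<theta>" using pos by simp
    \<comment> \<open>The constants come from \<open>l\<^sup>2 = c * \<delta>\<^sup>2 / 25\<close>,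
      from segments of length at least \<open>c * n\<close>, and from
      \<open>\<mu>\<^sup>2 = \<eta>\<^sup>2 * n\<close>. The three terms vanish by the rate
      assumption, by the lower end of the window for \<open>d\<close>, and by
      \<open>d = o(n)\<close>.\<close>
    have bound: "\<forall>\<^sub>F n in sequentially. prob (bad n) \<le> 2 * v * (50 / c\<^sup>2 * ((1 + ln (real n)) / ((\<delta> n)\<^sup>2 * real n))
        + 100 / c * (1 / ((\<delta> n)\<^sup>2 * real (d n))) + 2 / \<eta>\<^sup>2 * (real (d n) / real n))"
      using k0_ev R_ev order_tendstoD(2)[OF lim(1) less_double] order_tendstoD(2)[OF lim(2) less_double] ln1
    proof eventually_elim
      case (elim n)
      have n: "1 \<le> n" "0 < real n" "0 < \<delta> n" "0 < real (d n)" using elim d1 by (auto simp: Suc_le_eq)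
      have \<rho>: "0 < \<rho> n i" "\<rho> n i \<le> 2 * \<theta>" for i
        using elim pos(1,2)[of n] by (auto simp: \<rho>_def)
      have e2: "(e n i \<omega>)\<^sup>2 = (\<rho> n i)\<^sup>2 * ((\<xi> n i \<omega>)\<^sup>2 - 1)\<^sup>2" for i \<omega>
        by (simp add: e_def power_mult_distrib)
      have mom: "integrable M (\<lambda>\<omega>. ((\<xi> n i \<omega>)\<^sup>2 - 1)\<^sup>2)"
        "expectation (\<lambda>\<omega>. (\<xi> n i \<omega>)\<^sup>2 - 1) = 0" "expectation (\<lambda>\<omega>. ((\<xi> n i \<omega>)\<^sup>2 - 1)\<^sup>2) = 2"
        if i: "i \<in> {1..n}" for i
      proof -
        have law': "distr M borel (\<xi> n i) = std_normal_distribution" using law i by simp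
        show "integrable M (\<lambda>\<omega>. ((\<xi> n i \<omega>)\<^sup>2 - 1)\<^sup>2)"
          using integrable_distr[OF \<xi>m[OF i], of "\<lambda>y. (y\<^sup>2 - 1)\<^sup>2"] std_normal_square_moments(1)
          by (simp add: law')
        show "expectation (\<lambda>\<omega>. (\<xi> n i \<omega>)\<^sup>2 - 1) = 0"
          using integral_distr[OF \<xi>m[OF i], of "\<lambda>y. y\<^sup>2 - 1"] std_normal_square_moments(2)
          by (simp add: law')
        show "expectation (\<lambda>\<omega>. ((\<xi> n i \<omega>)\<^sup>2 - 1)\<^sup>2) = 2"
          using integral_distr[OF \<xi>m[OF i], of "\<lambda>y. (y\<^sup>2 - 1)\<^sup>2"] std_normal_square_moments(3)
          by (simp add: law')
      qed
      have "prob (bad n) \<le> 2 * v * ((1 + ln (real (k0 n))) / ((l n)\<^sup>2 * real (k0 n))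
          + (1 + ln (real (n - k0 n))) / ((l n)\<^sup>2 * real (n - k0 n))
          + 4 / ((l n)\<^sup>2 * real (d n)) + 2 * real (d n) / (\<mu> n)\<^sup>2)"
        unfolding bad_def
      proof (rule prob_not_all_tame_le)
        show "indep_vars (\<lambda>_. borel) (e n) {1..n}"
          unfolding e_def[abs_def]
          by (rule indep_vars_compose2[OF ind[OF n(1)], of "\<lambda>i x. \<rho> n i * (x\<^sup>2 - 1)"]) measurable
        show "integrable M (\<lambda>\<omega>. (e n i \<omega>)\<^sup>2)" if "i \<in> {1..n}" for i
          unfolding e2 using mom(1)[OF that] by simp
        show "expectation (e n i) = 0" if "i \<in> {1..n}" for i
          unfolding e_def[abs_def] using mom(2)[OF that] by simp
        show "expectation (\<lambda>\<omega>. (e n i \<omega>)\<^sup>2) \<le> v" if "i \<in> {1..n}" for i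
        proof -
          have "expectation (\<lambda>\<omega>. (e n i \<omega>)\<^sup>2) = (\<rho> n i)\<^sup>2 * 2"
            unfolding e2 using mom(3)[OF that] by simp
          also have "\<dots> \<le> v"
            using power_mono[OF \<rho>(2)[of i], of 2] \<rho>(1)[of i] by (simp add: v_def)
          finally show ?thesis .
        qed
        show "0 < l n" "0 < \<mu> n" using \<kappa> \<eta> n by (simp_all add: l_def \<mu>_def)
      qed (use elim d1 in auto)
      also have "\<dots> \<le> 2 * v * ((1 + ln (real n)) / ((l n)\<^sup>2 * (c * real n))
          + (1 + ln (real n)) / ((l n)\<^sup>2 * (c * real n))
          + 4 / ((l n)\<^sup>2 * real (d n)) + 2 * real (d n) / (\<mu> n)\<^sup>2)"
        using elim n c \<kappa> \<eta> by (intro mult_left_mono add_mono frac_le) (auto simp: v_def l_def \<mu>_def)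
      also have "\<dots> = 2 * v * (50 / c\<^sup>2 * ((1 + ln (real n)) / ((\<delta> n)\<^sup>2 * real n))
        + 100 / c * (1 / ((\<delta> n)\<^sup>2 * real (d n))) + 2 / \<eta>\<^sup>2 * (real (d n) / real n))"
      proof -
        have l2: "(l n)\<^sup>2 = c * (\<delta> n)\<^sup>2 / 25" by (simp add: l_def power_mult_distrib power_divide \<kappa>)
        have \<mu>2: "(\<mu> n)\<^sup>2 = \<eta>\<^sup>2 * real n" by (simp add: \<mu>_def power_mult_distrib)
        have p1: "(1 + ln (real n)) / ((l n)\<^sup>2 * (c * real n)) = 25 / c\<^sup>2 * ((1 + ln (real n)) / ((\<delta> n)\<^sup>2 * real n))"
          unfolding l2 by (simp add: power2_eq_square ac_simps)
        have p2: "4 / ((l n)\<^sup>2 * real (d n)) = 100 / c * (1 / ((\<delta> n)\<^sup>2 * real (d n)))"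
          unfolding l2 by simp
        have p3: "2 * real (d n) / (\<mu> n)\<^sup>2 = 2 / \<eta>\<^sup>2 * (real (d n) / real n)"
          unfolding \<mu>2 by simp
        have "25 / c\<^sup>2 * x + 25 / c\<^sup>2 * x = 50 / c\<^sup>2 * x" for x
          by simp
        then show ?thesis unfolding p1 p2 p3 by simp
      qed
      finally show ?case .
    qed
    have "(\<lambda>n. 2 * v * (50 / c\<^sup>2 * ((1 + ln (real n)) / ((\<delta> n)\<^sup>2 * real n))
        + 100 / c * (1 / ((\<delta> n)\<^sup>2 * real (d n))) + 2 / \<eta>\<^sup>2 * (real (d n) / real n)))
        \<longlonglongrightarrow> 2 * v * (50 / c\<^sup>2 * 0 + 100 / c * 0 + 2 / \<eta>\<^sup>2 * 0)"
      by (intro tendsto_intros ln_lim d2 d4)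
    then have "(\<lambda>n. 2 * v * (50 / c\<^sup>2 * ((1 + ln (real n)) / ((\<delta> n)\<^sup>2 * real n))
        + 100 / c * (1 / ((\<delta> n)\<^sup>2 * real (d n))) + 2 / \<eta>\<^sup>2 * (real (d n) / real n))) \<longlonglongrightarrow> 0"
      by simp
    moreover have "\<forall>\<^sub>F n in sequentially. prob {\<omega>\<in>space M. \<epsilon> \<le> norm (sqrt (real n) *\<^sub>R (vector [D1 n \<omega>, D2 n \<omega>] :: real^2)
      - vector [a n * A n \<omega>, b n * B n \<omega>])}
      \<le> 2 * v * (50 / c\<^sup>2 * ((1 + ln (real n)) / ((\<delta> n)\<^sup>2 * real n))
        + 100 / c * (1 / ((\<delta> n)\<^sup>2 * real (d n))) + 2 / \<eta>\<^sup>2 * (real (d n) / real n))"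
      using sub bound
    proof eventually_elim
      case (elim n)
      show ?case by (rule order_trans[OF finite_measure_mono[OF elim(1) bad_sets] elim(2)])
    qed
    ultimately show ?thesis
      by (rule tendsto_sandwich[OF always_eventually[OF allI[OF measure_nonneg]] _ tendsto_const, rotated])
  qed
  from converges_in_distribution_slutsky[OF \<open>prob_space M\<close> L leading meas small]
  show ?thesis by (simp add: D1_def D2_def)
qed

text \<open>Since \<open>\<sigma>\<close> vanishes nowhere, the residual of an Euler step cancels
  drift and diffusion coefficient exactly, wherever the path is, and leaves
  \<open>sqrt \<theta>\<close> times a standardized Brownian increment.\<close>

theorem theorem3p4:
  fixes M :: "'a measure"
    and W :: "real \<Rightarrow> 'a \<Rightarrow> real"
    and l r :: ereal
    and b \<sigma> :: "real \<Rightarrow> real"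
    and x0 T \<tau>0 \<theta>0 :: real
    and \<Theta> :: "real set"
    and \<theta>1 \<theta>2 \<Delta> :: "nat \<Rightarrow> real"
    and k0 :: "nat \<Rightarrow> nat"
    and X Z :: "nat \<Rightarrow> nat \<Rightarrow> 'a \<Rightarrow> real"
    and kh :: "nat \<Rightarrow> 'a \<Rightarrow> nat"
    and \<theta>h1 \<theta>h2 :: "nat \<Rightarrow> 'a \<Rightarrow> real"
  assumes BM: "standard_brownian_motion M W"
    (* the known coefficients on the state space I = (l, r) *)
    and x0_in: "x0 \<in> einterval l r"
    and b_C1: "b C1_differentiable_on einterval l r"
    and \<sigma>_C1: "\<sigma> C1_differentiable_on einterval l r"
    and \<sigma>_pos: "\<And>x. x \<in> einterval l r \<Longrightarrow> 0 < \<sigma> x"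
    (* outside I the coefficients are an arbitrary extension, needed because the Gaussian Euler
       scheme leaves I when I is not the whole line; void if I is the whole line *)
    and \<sigma>_ext: "\<And>x. x \<notin> einterval l r \<Longrightarrow> \<sigma> x \<noteq> 0"
    and scale_l: "\<And>x. x \<in> einterval l r \<Longrightarrow>
      filterlim (\<lambda>y. LBINT u=ereal x..y. scale_density b \<sigma> x0 u) at_bot (at_right l)"
    and scale_r: "\<And>x. x \<in> einterval l r \<Longrightarrow>
      filterlim (\<lambda>y. LBINT u=ereal x..y. scale_density b \<sigma> x0 u) at_top (at_left r)"
    (* sampling scheme and change point *)
    and T_pos: "0 < T"
    and horizon: "\<And>n. 1 \<le> n \<Longrightarrow> real n * \<Delta> n = T"
    and mesh: "\<Delta> \<longlonglongrightarrow> 0"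
    and \<tau>0: "0 < \<tau>0" "\<tau>0 < 1"
    and k0: "\<And>n. k0 n = nat \<lfloor>real n * \<tau>0\<rfloor>"
    (* diffusion parameters *)
    and \<Theta>: "compact \<Theta>" "\<Theta> \<subseteq> {0<..}"
    and \<theta>_in: "\<And>n. \<theta>1 n \<in> \<Theta>" "\<And>n. \<theta>2 n \<in> \<Theta>"
    and shrink: "(\<lambda>n. \<theta>2 n - \<theta>1 n) \<longlonglongrightarrow> 0"
    and rate: "filterlim (\<lambda>n. sqrt (real n) * (\<theta>2 n - \<theta>1 n) / sqrt (ln (real n)))
                 at_top sequentially"
    and \<theta>_lim: "\<theta>1 \<longlonglongrightarrow> \<theta>0" "\<theta>2 \<longlonglongrightarrow> \<theta>0"
    (* Euler scheme *)
    and X_0: "\<And>n \<omega>. \<omega> \<in> space M \<Longrightarrow> X n 0 \<omega> = x0"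
    and X_Euler: "\<And>n i \<omega>. \<lbrakk>1 \<le> i; i \<le> n; \<omega> \<in> space M\<rbrakk> \<Longrightarrow>
      X n i \<omega> = X n (i - 1) \<omega> + b (X n (i - 1) \<omega>) * \<Delta> n
        + sqrt (if i \<le> k0 n then \<theta>1 n else \<theta>2 n) * \<sigma> (X n (i - 1) \<omega>)
            * (W (real i * \<Delta> n) \<omega> - W (real (i - 1) * \<Delta> n) \<omega>)"
    (* estimators *)
    and Z: "\<And>n i \<omega>. Z n i \<omega> = standardized_residual b \<sigma> (\<Delta> n) (\<lambda>j. X n j \<omega>) i"
    and kh: "\<And>n. 2 \<le> n \<Longrightarrow> least_squares_change_point M n (Z n) (kh n)"
    and \<theta>h1: "\<And>n \<omega>. \<theta>h1 n \<omega> = mean_sq_before (\<lambda>i. Z n i \<omega>) (kh n \<omega>)"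
    and \<theta>h2: "\<And>n \<omega>. \<theta>h2 n \<omega> = mean_sq_after n (\<lambda>i. Z n i \<omega>) (kh n \<omega>)"
  shows "converges_in_distribution M
     (\<lambda>n \<omega>. sqrt (real n) *\<^sub>R
        (vector [\<theta>h1 n \<omega> - \<theta>1 n, \<theta>h2 n \<omega> - \<theta>2 n] :: real^2))
     (multivariate_normal 0
        (vector [vector [2 * inverse \<tau>0 * \<theta>0\<^sup>2, 0],
                 vector [0, 2 * inverse (1 - \<tau>0) * \<theta>0\<^sup>2]] :: real^2^2))"
proof -
  have M: "prob_space M" using BM by (simp add: standard_brownian_motion_def)
  have \<Delta>_pos: "0 < \<Delta> n" if "1 \<le> n" for n
    using horizon[OF that] T_pos that zero_less_mult_pos[of "real n" "\<Delta> n"] by simp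
  have \<theta>_pos: "0 < \<theta>1 n" "0 < \<theta>2 n" for n
    using \<theta>_in[of n] \<Theta>(2) by auto
  \<comment> \<open>Positivity of the limit, hence a nondegenerate normal law, comes from
    compactness: \<open>\<Theta>\<close> is closed and stays away from 0.\<close>
  have "\<theta>0 \<in> \<Theta>"
    using closed_sequentially[OF compact_imp_closed[OF \<Theta>(1)] _ \<theta>_lim(1)] \<theta>_in(1) by blast
  then have \<theta>0_pos: "0 < \<theta>0" using \<Theta>(2) by auto
  have \<sigma>_nz: "\<sigma> x \<noteq> 0" for x
    using \<sigma>_pos[of x] \<sigma>_ext[of x] by (cases "x \<in> einterval l r") auto
  define \<xi> where "\<xi> n i \<omega> = (W (real i * \<Delta> n) \<omega> - W (real (i - 1) * \<Delta> n) \<omega>) / sqrt (\<Delta> n)" for n i \<omega>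
  have Z_eq: "Z n i \<omega> = sqrt (if i \<le> k0 n then \<theta>1 n else \<theta>2 n) * \<xi> n i \<omega>"
    if "1 \<le> i" "i \<le> n" "\<omega> \<in> space M" for n i \<omega>
    using X_Euler[OF that] \<sigma>_nz[of "X n (i - 1) \<omega>"] \<Delta>_pos[of n] that
    by (simp add: Z standardized_residual_def \<xi>_def)
  have "converges_in_distribution M
     (\<lambda>n \<omega>. sqrt (real n) *\<^sub>R
        (vector [mean_sq_before (\<lambda>i. Z n i \<omega>) (kh n \<omega>) - \<theta>1 n,
                 mean_sq_after n (\<lambda>i. Z n i \<omega>) (kh n \<omega>) - \<theta>2 n] :: real^2))
     (multivariate_normal 0
        (vector [vector [2 * inverse \<tau>0 * \<theta>0\<^sup>2, 0],
                 vector [0, 2 * inverse (1 - \<tau>0) * \<theta>0\<^sup>2]] :: real^2^2))"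
  proof (rule least_squares_change_point_clt[OF M _ _ \<tau>0 k0 \<theta>_pos \<theta>0_pos \<theta>_lim rate Z_eq kh])
    show "prob_space.indep_vars M (\<lambda>_. borel) (\<xi> n) {1..n}" if "1 \<le> n" for n
      unfolding \<xi>_def[abs_def] by (rule standard_brownian_motion_increments(1)[OF BM \<Delta>_pos[OF that]])
    show "distr M borel (\<xi> n i) = std_normal_distribution" if "1 \<le> i" "i \<le> n" for n i
      unfolding \<xi>_def[abs_def] using that
      by (intro standard_brownian_motion_increments(2)[OF BM \<Delta>_pos]) auto
  qed
  then show ?thesis by (simp add: \<theta>h1 \<theta>h2)
qed

end
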